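(* Let $\Pi^n$ be the empirical Bayes posterior for $\beta$ (defined in the context), and let $s^\star = s^\star_n$ be a sequence such that $s^\star \log(p/s^\star) = o(n)$ as $n \to \infty$. Set $\varepsilon_n^2 = n^{-1} s^\star \log(p/s^\star)$, so that $\varepsilon_n \to 0$. Then there exist constants $G, M > 0$ such that $$\sup_{\beta^\star \in \mathbb{R}^p:\, |S_{\beta^\star}| = s^\star} \mathsf{E}_{\beta^\star}\, \Pi^n\bigl(\{\beta \in \mathbb{R}^p : h(\beta^\star, \beta) > M \varepsilon_n\}\bigr) \lesssim e^{-G n \varepsilon_n^2} \to 0,$$ where $h(\beta^\star,\beta) = \bigl\{\int h_{\tilde x}^2(\beta^\star,\beta)\, Q_n(d\tilde x)\bigr\}^{1/2}$, $h_{\tilde x}(\beta^\star,\beta)$ is the Hellinger distance between $\mathsf{N}(\tilde x^\top\beta,\sigma^2)$ and $\mathsf{N}(\tilde x^\top\beta^\star,\sigma^2)$, and $Q_n$ is the empirical distribution of the $n$ rows of $X$.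
   Context: Model: $y = X\beta + \sigma z$, with $y \in \mathbb{R}^n$, $X$ a (non-random) $n \times p$ matrix, $z$ a vector of $n$ independent standard normals, and $\sigma^2 > 0$ known. Asymptotics are as $n\to\infty$, with $p = p_n \ge n$ and $X = X_n$ depending on $n$; the rank $R$ of $X$ equals $n$. $\mathsf{E}_{\beta^\star}$ is expectation over $y \sim \mathsf{N}_n(X\beta^\star, \sigma^2 I)$. For $\beta\in\mathbb{R}^p$, $S_\beta = \{j : \beta_j \neq 0\}$, and $|S|$ is the cardinality of $S$. The sparsity level $s^\star$ is a positive integer. The symbol $\lesssim$ means inequality up to a constant factor not depending on $n$ or $\beta^\star$. Empirical prior: for $S \subseteq \{1,\dots,p\}$ with $|S| \le R$, $\pi(S) = \binom{p}{|S|}^{-1} q_n(|S|)$, where $q_n$ is the probability mass function on $\{0,1,\dots,R\}$ with $q_n(s) \propto (c p^a)^{-s}$, and $a, c > 0$ are fixed constants. Let $X_S$ be the $n \times |S|$ submatrix of $X$ with columns indexed by $S$ ($X_S^\top X_S$ is taken to be invertible for the $S$ supported by the prior) and $\hat\beta_S = (X_S^\top X_S)^{-1} X_S^\top y$ the least squares estimator. Fix constants $\gamma > 0$ and $\alpha \in (0,1)$. The prior is $$\Pi_n(d\beta) = \sum_S \pi(S)\, \mathsf{N}_{|S|}\bigl(d\beta_S \mid \hat\beta_S, \sigma^2\gamma^{-1}(X_S^\top X_S)^{-1}\bigr) \otimes \delta_{0_{S^c}}(d\beta_{S^c}),$$ where $\delta_{0_{S^c}}$ is the point mass at the origin for the coordinates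 in $S^c$. Empirical Bayes posterior: $\Pi^n(d\beta) \propto L_n(\beta)^\alpha\, \Pi_n(d\beta)$, with $L_n(\beta) = \mathsf{N}_n(y \mid X\beta, \sigma^2 I) \propto \exp\{-\|y - X\beta\|^2/(2\sigma^2)\}$. The Hellinger distance between densities $f,g$ is $\{\int (\sqrt{f}-\sqrt{g})^2\}^{1/2}$.
   Formalization: The added assumption log p = O(log(p/s* )) (sparse regime) is needed: for p = n, s* = n/log n and a suitable orthogonal X the posterior can collapse to 0 and the bound fails, and for s* = p = n the limit e^{-G n ε_n²} → 0 fails. *)

theory Defs
  imports
    "HOL-Probability.Probability"
    "HOL-Library.Landau_Symbols"
    "Jordan_Normal_Form.Determinant"
    "Jordan_Normal_Form.Gauss_Jordan_Elimination"
    "Jordan_Normal_Form.DL_Rank"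
    "Jordan_Normal_Form.DL_Submatrix"
begin

text \<open>
  Vectors and matrices of varying size are those of Jordan_Normal_Form, with indices
  starting at 0; in particular models are sets of column indices below the number of columns.
\<close>

definition mat_inv :: "real mat \<Rightarrow> real mat" where
  "mat_inv A = the (mat_inverse A)"


subsection \<open>Multivariate normal distributions\<close>

text \<open>Lebesgue-Borel measure on \<^term>\<open>carrier_vec n\<close>; a point mass if \<open>n = 0\<close>.\<close>

definition lborel_vec :: "nat \<Rightarrow> real Matrix.vec measure" where
  "lborel_vec n = embed_measure (\<Pi>\<^sub>M i\<in>{..<n}. lborel) (Matrix.vec n)"

definition mvn_density :: "real Matrix.vec \<Rightarrow> real mat \<Rightarrow> real Matrix.vec \<Rightarrow> real" where
  "mvn_density \<mu> \<Sigma> x =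
     exp (- scalar_prod (x - \<mu>) (mat_inv \<Sigma> *\<^sub>v (x - \<mu>)) / 2)
       / sqrt ((2 * pi) ^ dim_vec \<mu> * Determinant.det \<Sigma>)"

definition mvn :: "real Matrix.vec \<Rightarrow> real mat \<Rightarrow> real Matrix.vec measure" where
  "mvn \<mu> \<Sigma> = density (lborel_vec (dim_vec \<mu>)) (\<lambda>x. ennreal (mvn_density \<mu> \<Sigma> x))"


subsection \<open>The linear model\<close>

definition supp :: "real Matrix.vec \<Rightarrow> nat set" where
  "supp \<beta> = {j. j < dim_vec \<beta> \<and> \<beta> $ j \<noteq> 0}"

definition mat_rank :: "real mat \<Rightarrow> nat" where
  "mat_rank A = vec_space.rank (dim_row A) A"

definition sub_cols :: "real mat \<Rightarrow> nat set \<Rightarrow> real mat" where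
  "sub_cols X S = submatrix X UNIV S"

definition gram :: "real mat \<Rightarrow> nat set \<Rightarrow> real mat" where
  "gram X S = transpose_mat (sub_cols X S) * sub_cols X S"

definition lse :: "real mat \<Rightarrow> real Matrix.vec \<Rightarrow> nat set \<Rightarrow> real Matrix.vec" where
  "lse X y S = mat_inv (gram X S) *\<^sub>v (transpose_mat (sub_cols X S) *\<^sub>v y)"

definition response_density ::
    "real mat \<Rightarrow> real \<Rightarrow> real Matrix.vec \<Rightarrow> real Matrix.vec \<Rightarrow> real" where
  "response_density X \<sigma> \<beta> y = mvn_density (X *\<^sub>v \<beta>) (\<sigma>\<^sup>2 \<cdot>\<^sub>m 1\<^sub>m (dim_row X)) y"

definition response_dist :: "real mat \<Rightarrow> real \<Rightarrow> real Matrix.vec \<Rightarrow> real Matrix.vec measure" where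
  "response_dist X \<sigma> \<beta> = mvn (X *\<^sub>v \<beta>) (\<sigma>\<^sup>2 \<cdot>\<^sub>m 1\<^sub>m (dim_row X))"


subsection \<open>Empirical prior and posterior\<close>

definition size_prior :: "real \<Rightarrow> real \<Rightarrow> nat \<Rightarrow> nat \<Rightarrow> nat \<Rightarrow> real" where
  "size_prior a c p R s =
     (if s \<le> R then inverse ((c * real p powr a) ^ s) / (\<Sum>t\<le>R. inverse ((c * real p powr a) ^ t))
      else 0)"

definition model_prior :: "real \<Rightarrow> real \<Rightarrow> real mat \<Rightarrow> nat set \<Rightarrow> real" where
  "model_prior a c X S =
     (if S \<subseteq> {..<dim_col X} \<and> card S \<le> mat_rank X
      then inverse (real (dim_col X choose card S)) * size_prior a c (dim_col X) (mat_rank X) (card S)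
      else 0)"

text \<open>
  Pads \<^term>\<open>b\<close>, whose entries are the coefficients of the columns in \<^term>\<open>S\<close> in increasing
  order, with zeros off \<^term>\<open>S\<close>. The image of a distribution of \<open>\<beta>\<^sub>S\<close> under this map is its
  product with the point mass at the origin for the coordinates outside \<^term>\<open>S\<close>.
\<close>

definition pad_zeros :: "nat \<Rightarrow> nat set \<Rightarrow> real Matrix.vec \<Rightarrow> real Matrix.vec" where
  "pad_zeros p S b = Matrix.vec p (\<lambda>j. if j \<in> S then b $ card {i \<in> S. i < j} else 0)"

definition model_component ::
    "real \<Rightarrow> real \<Rightarrow> real mat \<Rightarrow> real Matrix.vec \<Rightarrow> nat set \<Rightarrow> real Matrix.vec measure" where
  "model_component \<sigma> \<gamma> X y S =
     distr (mvn (lse X y S) ((\<sigma>\<^sup>2 / \<gamma>) \<cdot>\<^sub>m mat_inv (gram X S)))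
       (lborel_vec (dim_col X)) (pad_zeros (dim_col X) S)"

definition emp_prior ::
    "real \<Rightarrow> real \<Rightarrow> real \<Rightarrow> real \<Rightarrow> real mat \<Rightarrow> real Matrix.vec \<Rightarrow> real Matrix.vec measure" where
  "emp_prior \<sigma> \<gamma> a c X y =
     measure_of (space (lborel_vec (dim_col X))) (sets (lborel_vec (dim_col X)))
       (\<lambda>A. \<Sum>S\<in>Pow {..<dim_col X}.
          ennreal (model_prior a c X S) * emeasure (model_component \<sigma> \<gamma> X y S) A)"

definition unnorm_posterior ::
    "real \<Rightarrow> real \<Rightarrow> real \<Rightarrow> real \<Rightarrow> real \<Rightarrow> real mat \<Rightarrow> real Matrix.vec \<Rightarrow> real Matrix.vec measure" where
  "unnorm_posterior \<sigma> \<alpha> \<gamma> a c X y =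
     density (emp_prior \<sigma> \<gamma> a c X y) (\<lambda>\<beta>. ennreal (response_density X \<sigma> \<beta> y powr \<alpha>))"

definition posterior ::
    "real \<Rightarrow> real \<Rightarrow> real \<Rightarrow> real \<Rightarrow> real \<Rightarrow> real mat \<Rightarrow> real Matrix.vec \<Rightarrow> real Matrix.vec measure" where
  "posterior \<sigma> \<alpha> \<gamma> a c X y =
     (let U = unnorm_posterior \<sigma> \<alpha> \<gamma> a c X y in scale_measure (inverse (emeasure U (space U))) U)"


subsection \<open>Hellinger distance and rate\<close>

definition hellinger :: "(real \<Rightarrow> real) \<Rightarrow> (real \<Rightarrow> real) \<Rightarrow> real" where
  "hellinger f g = sqrt (\<integral>u. (sqrt (f u) - sqrt (g u))\<^sup>2 \<partial>lborel)"

definition pred_hellinger ::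
    "real \<Rightarrow> real Matrix.vec \<Rightarrow> real Matrix.vec \<Rightarrow> real Matrix.vec \<Rightarrow> real" where
  "pred_hellinger \<sigma> x \<beta>' \<beta> =
     hellinger (normal_density (scalar_prod x \<beta>) \<sigma>) (normal_density (scalar_prod x \<beta>') \<sigma>)"

text \<open>The empirical distribution of the rows counts repeated rows with multiplicity.\<close>

definition row_dist :: "real mat \<Rightarrow> real Matrix.vec pmf" where
  "row_dist X = map_pmf (Matrix.row X) (pmf_of_set {..<dim_row X})"

definition mean_hellinger ::
    "real \<Rightarrow> real mat \<Rightarrow> real Matrix.vec \<Rightarrow> real Matrix.vec \<Rightarrow> real" where
  "mean_hellinger \<sigma> X \<beta>' \<beta> =
     sqrt (measure_pmf.expectation (row_dist X) (\<lambda>x. (pred_hellinger \<sigma> x \<beta>' \<beta>)\<^sup>2))"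

text \<open>
  The prior mass of a single model of size \<open>s\<close> is of order \<open>exp (- s ln p)\<close> up to a constant factor
  in the exponent, so \<open>s ln (p / s)\<close> below is the right exponent only in the sparse regime
  where \<open>ln (p / s)\<close> and \<open>ln p\<close> are of the same order.
\<close>

definition rate :: "(nat \<Rightarrow> nat) \<Rightarrow> (nat \<Rightarrow> nat) \<Rightarrow> nat \<Rightarrow> real" where
  "rate p s n = sqrt (real (s n) * ln (real (p n) / real (s n)) / real n)"

end

theory Submission
  imports Defs "HOL-Real_Asymp.Real_Asymp"
begin

text \<open>
  Write \<open>\<mu> = X \<beta>'\<close> for the true mean and \<open>P\<close> for the projection onto the column space of \<open>X\<^sub>S\<close>. Since
  \<open>h\<^sup>2 \<le> \<parallel>X \<beta> - \<mu>\<parallel>\<^sup>2 / (4 \<sigma>\<^sup>2 n)\<close>, the event in the theorem forces a large prediction error, and its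
  indicator is at most \<open>exp (t \<parallel>X \<beta> - \<mu>\<parallel>\<^sup>2 / \<sigma>\<^sup>2 - 4 t M\<^sup>2 s ln (p / s))\<close>. For \<open>t = \<alpha> (1 - \<alpha>) / 8\<close> the
  exponential moment is absorbed by the tempered likelihood: after integrating out \<open>\<beta>\<^sub>S\<close> against the
  prior, the likelihood ratio is a Gaussian integral in \<open>y\<close> whose precision matrix is
  \<open>(I - (4 t + \<alpha>) P) / \<sigma>\<^sup>2\<close>, so its expectation is at most \<open>r ^ card S\<close> for a constant \<open>r\<close>. The
  normalising constant of the posterior is bounded below by the contribution of the true model alone.
  Averaging over \<open>S\<close> is harmless because the geometric prior on the model size beats \<open>r ^ card S\<close>, and
  the price for the prior mass of the true model is \<open>exp (O (s ln p))\<close>, which is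
  \<open>exp (O (s ln (p / s)))\<close> by sparsity and is compensated by taking \<open>M\<close> large.
\<close>

hide_type (open) Finite_Cartesian_Product.vec
hide_const (open) Finite_Cartesian_Product.vec Finite_Cartesian_Product.mat
  Finite_Cartesian_Product.row Finite_Cartesian_Product.column
  Finite_Cartesian_Product.transpose Finite_Cartesian_Product.vec_nth Determinants.det
no_notation Finite_Cartesian_Product.vec_nth (infixl "$" 90)
unbundle no inner_syntax
notation scalar_prod (infix "\<bullet>" 70)

subsection \<open>Gaussian integrals\<close>

text \<open>The prior is centred at the least squares estimate and so depends on the response; prior
  and sampling expectations cannot be interchanged. Hence all bounds are made for fixed
  \<open>y\<close> until the coefficients are integrated out. That integral is explicit because
  prior component and likelihood are Gaussian in the coefficients with the same centre. The
  expectation over \<open>y\<close> comes last and meets only an exponent quadratic in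
  \<open>y\<close>. Three demands shape \<open>t\<close>. The deviation of the coefficients is to be
  absorbed by the likelihood: \<open>4 * t \<le> \<alpha>\<close>. The bias of a model that misses
  part of the truth is to be paid by its loss of fit:
  \<open>2 * t \<le> \<alpha> * (1 - \<alpha>)\<close>, which leaves room for a positive
  \<open>t\<close> because the power is below 1. The noise inside the column space is amplified by
  overfitting and by the prediction error, and the precision stays positive if
  \<open>4 * t + \<alpha> < 1\<close>. Everything is expressed through projections, so no eigenvalue
  of a Gram matrix enters, and the determinants involved depend on \<open>card S\<close> but not on
  the direction of the column space. A model is thus charged for its size alone, a charge that a
  geometric prior can meet.\<close>

lemma scalar_prod_mult_mat_vec_eq_sum:
  fixes A :: "real mat"
  assumes "A \<in> carrier_mat n n" "x \<in> carrier_vec n"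
  shows "x \<bullet> (A *\<^sub>v x) = (\<Sum>i<n. \<Sum>j<n. A $$ (i,j) * x $ i * x $ j)"
proof -
  have "x \<bullet> (A *\<^sub>v x) = (\<Sum>i<n. x $ i * (A *\<^sub>v x) $ i)"
    using assms by (auto simp: scalar_prod_def atLeast0LessThan)
  also have "\<dots> = (\<Sum>i<n. \<Sum>j<n. A $$ (i,j) * x $ i * x $ j)"
    using assms
    by (intro sum.cong refl) (auto simp: scalar_prod_def atLeast0LessThan sum_distrib_left algebra_simps intro!: sum.cong)
  finally show ?thesis .
qed

lemma nn_integral_gaussian_1d:
  fixes d m :: real
  assumes "d > 0"
  shows "(\<integral>\<^sup>+\<xi>. ennreal (exp (- (d * (\<xi> - m)\<^sup>2) / 2)) \<partial>lborel) = ennreal (sqrt (2 * pi / d))"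
proof -
  have eq: "exp (- (d * (\<xi> - m)\<^sup>2) / 2) = sqrt (2 * pi / d) * normal_density m (1 / sqrt d) \<xi>" for \<xi>
  proof -
    have "(1 / sqrt d)\<^sup>2 = 1 / d" using assms by (simp add: power_divide)
    then show ?thesis using assms
      unfolding normal_density_def by (simp add: real_sqrt_divide real_sqrt_mult field_simps)
  qed
  interpret prob_space "density lborel (normal_density m (1 / sqrt d))"
    using assms by (intro prob_space_normal_density) simp
  have "(\<integral>\<^sup>+\<xi>. ennreal (normal_density m (1 / sqrt d) \<xi>) \<partial>lborel) = 1"
    using emeasure_space_1 by (simp add: emeasure_density)
  then show ?thesis
    unfolding eq using assms
    by (subst ennreal_mult) (auto simp: nn_integral_cmult)
qed

text \<open>\<open>A\<close> factors as \<open>?T * ?E\<close>: a block upper triangular matrix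
  containing the Schur complement of the last pivot, times a unit lower triangular one. Eliminating
  the last index matches the order in which coordinates are integrated out below.\<close>

lemma det_schur_complement:
  fixes A :: "real mat"
  assumes A: "A \<in> carrier_mat (Suc n) (Suc n)" and d: "A $$ (n,n) \<noteq> 0"
  shows "det A = A $$ (n,n) * det (mat n n (\<lambda>(i,j). A $$ (i,j) - A $$ (i,n) * A $$ (n,j) / A $$ (n,n)))"
proof -
  let ?d = "A $$ (n,n)"
  let ?C = "mat n n (\<lambda>(i,j). A $$ (i,j) - A $$ (i,n) * A $$ (n,j) / ?d)"
  let ?b = "mat n 1 (\<lambda>(i,j). A $$ (i,n))"
  let ?D = "mat 1 1 (\<lambda>_. ?d)"
  let ?T = "four_block_mat ?C ?b (0\<^sub>m 1 n) ?D"
  let ?E = "four_block_mat (1\<^sub>m n) (0\<^sub>m n 1) (mat 1 n (\<lambda>(i,j). A $$ (n,j) / ?d)) (1\<^sub>m 1)"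
  have "?T * ?E = A"
  proof (rule eq_matI)
    fix i j assume "i < dim_row A" "j < dim_col A"
    then have ij: "i < Suc n" "j < Suc n" using A by auto
    show "(?T * ?E) $$ (i,j) = A $$ (i,j)"
      using ij d
      by (subst mult_four_block_mat[of _ n n _ 1 _ 1 _ _ n _ 1])
         (auto simp: scalar_prod_def less_Suc_eq field_simps)
  qed (use A in auto)
  then have "det A = det (?T * ?E)" by simp
  also have "\<dots> = det ?T * det ?E"
    by (rule det_mult[of _ "n+1"]) auto
  also have "det ?T = det ?C * det ?D"
    by (rule det_four_block_mat_lower_left_zero) auto
  also have "det ?E = det (1\<^sub>m n :: real mat) * det (1\<^sub>m 1 :: real mat)"
    by (rule det_four_block_mat_upper_right_zero) auto
  also have "det ?D = ?d" by (subst det_single) auto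
  finally show ?thesis by simp
qed

text \<open>Completing the square in the last variable. The coefficients left for the other
  variables are those of the Schur complement, so quadratic form and determinant are reduced in
  step.\<close>

lemma quadratic_form_split:
  fixes A :: "real mat" and z :: "nat \<Rightarrow> real"
  assumes sym: "\<And>i j. i < Suc n \<Longrightarrow> j < Suc n \<Longrightarrow> A $$ (i,j) = A $$ (j,i)"
    and d: "A $$ (n,n) \<noteq> 0"
  shows "(\<Sum>i<Suc n. \<Sum>j<Suc n. A $$ (i,j) * z i * z j) =
    A $$ (n,n) * (z n + (\<Sum>i<n. A $$ (i,n) * z i) / A $$ (n,n))\<^sup>2
    + (\<Sum>i<n. \<Sum>j<n. (A $$ (i,j) - A $$ (i,n) * A $$ (n,j) / A $$ (n,n)) * z i * z j)"
proof -
  let ?d = "A $$ (n,n)" and ?B = "\<Sum>i<n. A $$ (i,n) * z i"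
  let ?Q = "\<Sum>i<n. \<Sum>j<n. A $$ (i,j) * z i * z j"
  have B': "(\<Sum>j<n. A $$ (n,j) * z n * z j) = z n * ?B"
    using sym by (auto simp: sum_distrib_left intro!: sum.cong)
  have B'': "(\<Sum>i<n. A $$ (i,n) * z i * z n) = z n * ?B"
    by (auto simp: sum_distrib_left intro!: sum.cong)
  have L: "(\<Sum>i<Suc n. \<Sum>j<Suc n. A $$ (i,j) * z i * z j) = ?Q + 2 * z n * ?B + ?d * (z n)\<^sup>2"
    using B' B'' by (simp add: sum.distrib power2_eq_square)
  have "(\<Sum>i<n. \<Sum>j<n. A $$ (i,n) * A $$ (n,j) / ?d * z i * z j) = ?B * ?B / ?d"
    unfolding sum_product sum_divide_distrib using sym
    by (intro sum.cong refl) auto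
  then have R: "(\<Sum>i<n. \<Sum>j<n. (A $$ (i,j) - A $$ (i,n) * A $$ (n,j) / ?d) * z i * z j) = ?Q - ?B\<^sup>2 / ?d"
    by (simp add: left_diff_distrib sum_subtractf power2_eq_square)
  show ?thesis unfolding L R using d by (simp add: field_simps power2_eq_square)
qed

lemma measurable_PiM_exp_quadratic:
  fixes A :: "real mat" and \<mu> :: "nat \<Rightarrow> real"
  shows "(\<lambda>x. ennreal (exp (- (\<Sum>i<n. \<Sum>j<n. A $$ (i,j) * (x i - \<mu> i) * (x j - \<mu> j)) / 2)))
    \<in> borel_measurable (\<Pi>\<^sub>M i\<in>{..<n}. lborel)"
proof -
  have [measurable]: "(\<lambda>x. x i) \<in> borel_measurable (\<Pi>\<^sub>M i\<in>{..<n}. lborel)" if "i < n" for i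
    using measurable_component_singleton[of i "{..<n}" "\<lambda>_. lborel :: real measure"] that by simp
  have "(\<lambda>x. \<Sum>i<n. \<Sum>j<n. A $$ (i,j) * (x i - \<mu> i) * (x j - \<mu> j))
    \<in> borel_measurable (\<Pi>\<^sub>M i\<in>{..<n}. lborel)"
    by (intro borel_measurable_sum borel_measurable_times borel_measurable_diff) auto
  then show ?thesis by simp
qed

text \<open>Induction on the dimension: Fubini integrates the last coordinate against a
  one-dimensional Gaussian of precision \<open>A $$ (n,n)\<close>, and the Schur complement governs
  the rest. Positivity of the determinant is carried along because the step multiplies square roots
  of quotients by it.\<close>

lemma nn_integral_gaussian_PiM:
  fixes A :: "real mat" and \<mu> :: "nat \<Rightarrow> real"
  assumes "A \<in> carrier_mat n n"
    and "\<And>i j. i < n \<Longrightarrow> j < n \<Longrightarrow> A $$ (i,j) = A $$ (j,i)"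
    and "\<And>x :: nat \<Rightarrow> real. (\<exists>i<n. x i \<noteq> 0) \<Longrightarrow> (\<Sum>i<n. \<Sum>j<n. A $$ (i,j) * x i * x j) > 0"
  shows "det A > 0 \<and>
    (\<integral>\<^sup>+x. ennreal (exp (- (\<Sum>i<n. \<Sum>j<n. A $$ (i,j) * (x i - \<mu> i) * (x j - \<mu> j)) / 2))
       \<partial>(\<Pi>\<^sub>M i\<in>{..<n}. lborel)) = ennreal (sqrt ((2 * pi) ^ n / det A))"
  using assms
proof (induction n arbitrary: A)
  case 0
  then have "det A = 1" by (simp add: det_dim_zero)
  then show ?case by (simp add: PiM_empty nn_integral_count_space_finite)
next
  case (Suc n)
  let ?d = "A $$ (n,n)"
  define C where "C = mat n n (\<lambda>(i,j). A $$ (i,j) - A $$ (i,n) * A $$ (n,j) / ?d)"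
  let ?Q = "\<lambda>x :: nat \<Rightarrow> real. \<Sum>i<n. \<Sum>j<n. C $$ (i,j) * x i * x j"
  have d: "?d > 0"
  proof -
    have "(\<Sum>i<Suc n. \<Sum>j<Suc n. A $$ (i,j) * (if i = n then 1 else 0) * (if j = n then 1 else 0)) > 0"
      by (rule Suc.prems(3)) (auto intro!: exI[of _ n])
    then show ?thesis by simp
  qed
  have split: "(\<Sum>i<Suc n. \<Sum>j<Suc n. A $$ (i,j) * z i * z j) =
      ?d * (z n + (\<Sum>i<n. A $$ (i,n) * z i) / ?d)\<^sup>2 + ?Q z" for z
    using quadratic_form_split[of n A z] Suc.prems(2) d by (simp add: C_def)
  have C: "det C > 0 \<and>
    (\<integral>\<^sup>+x. ennreal (exp (- ?Q (\<lambda>i. x i - \<mu> i) / 2))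
       \<partial>(\<Pi>\<^sub>M i\<in>{..<n}. lborel)) = ennreal (sqrt ((2 * pi) ^ n / det C))"
  proof (rule Suc.IH)
    show "C \<in> carrier_mat n n" by (simp add: C_def)
    show "C $$ (i,j) = C $$ (j,i)" if "i < n" "j < n" for i j
      using that Suc.prems(2) by (simp add: C_def)
    fix x :: "nat \<Rightarrow> real" assume "\<exists>i<n. x i \<noteq> 0"
    then obtain i where i: "i < n" "x i \<noteq> 0" by blast
    \<comment> \<open>the last coordinate minimises the quadratic form for given \<open>x\<close>, leaving the Schur complement\<close>
    define z where "z = x(n := - (\<Sum>i<n. A $$ (i,n) * x i) / ?d)"
    have "(\<Sum>i<Suc n. \<Sum>j<Suc n. A $$ (i,j) * z i * z j) > 0"
      using i by (intro Suc.prems(3)) (auto simp: z_def intro!: exI[of _ i])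
    moreover have "z n + (\<Sum>i<n. A $$ (i,n) * z i) / ?d = 0"
      using d by (simp add: z_def)
    moreover have "?Q z = ?Q x" by (simp add: z_def)
    ultimately show "?Q x > 0" unfolding split by simp
  qed
  have det: "det A = ?d * det C"
    using det_schur_complement[OF Suc.prems(1)] d unfolding C_def by simp
  interpret product_sigma_finite "\<lambda>_::nat. lborel :: real measure" ..
  let ?f = "\<lambda>x. ennreal (exp (- (\<Sum>i<Suc n. \<Sum>j<Suc n. A $$ (i,j) * (x i - \<mu> i) * (x j - \<mu> j)) / 2))"
  have ins: "insert n {..<n} = {..<Suc n}" by auto
  have "(\<integral>\<^sup>+x. ?f x \<partial>(\<Pi>\<^sub>M i\<in>{..<Suc n}. lborel)) =
    (\<integral>\<^sup>+x. (\<integral>\<^sup>+\<xi>. ?f (x(n := \<xi>)) \<partial>lborel) \<partial>(\<Pi>\<^sub>M i\<in>{..<n}. lborel))"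
    using product_nn_integral_insert[of "{..<n}" n ?f] measurable_PiM_exp_quadratic[of A \<mu> "Suc n"]
    unfolding ins by simp
  also have "\<dots> = (\<integral>\<^sup>+x. ennreal (sqrt (2 * pi / ?d)) * ennreal (exp (- ?Q (\<lambda>i. x i - \<mu> i) / 2))
       \<partial>(\<Pi>\<^sub>M i\<in>{..<n}. lborel))"
  proof (rule nn_integral_cong)
    fix x :: "nat \<Rightarrow> real"
    \<comment> \<open>The conditional mean of the last coordinate given the others. It varies with
      \<open>x\<close>, but the inner integral does not depend on it.\<close>
    define m where "m = \<mu> n - (\<Sum>i<n. A $$ (i,n) * (x i - \<mu> i)) / ?d"
    have "(\<Sum>i<Suc n. \<Sum>j<Suc n. A $$ (i,j) * ((x(n := \<xi>)) i - \<mu> i) * ((x(n := \<xi>)) j - \<mu> j))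
      = ?d * (\<xi> - m)\<^sup>2 + ?Q (\<lambda>i. x i - \<mu> i)" for \<xi>
    proof -
      have *: "\<xi> - \<mu> n + (\<Sum>i<n. A $$ (i,n) * (x i - \<mu> i)) / ?d = \<xi> - m"
        by (simp add: m_def)
      show ?thesis
        unfolding split[of "\<lambda>i. (x(n := \<xi>)) i - \<mu> i"] *[symmetric] by simp
    qed
    then have "?f (x(n := \<xi>)) = ennreal (exp (- (?d * (\<xi> - m)\<^sup>2) / 2)) * ennreal (exp (- ?Q (\<lambda>i. x i - \<mu> i) / 2))" for \<xi>
      by (simp add: ennreal_mult'[symmetric] exp_add[symmetric] diff_divide_distrib)
    then show "(\<integral>\<^sup>+\<xi>. ?f (x(n := \<xi>)) \<partial>lborel) =
        ennreal (sqrt (2 * pi / ?d)) * ennreal (exp (- ?Q (\<lambda>i. x i - \<mu> i) / 2))"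
      using nn_integral_gaussian_1d[OF d, of m] by (simp add: nn_integral_multc)
  qed
  also have "\<dots> = ennreal (sqrt (2 * pi / ?d)) * ennreal (sqrt ((2 * pi) ^ n / det C))"
    using C measurable_PiM_exp_quadratic[of C \<mu> n] by (subst nn_integral_cmult) auto
  also have "\<dots> = ennreal (sqrt ((2 * pi) ^ Suc n / det A))"
    unfolding det using d C
    by (subst ennreal_mult[symmetric]) (auto simp: real_sqrt_mult[symmetric])
  finally show ?case using C d det by simp
qed

subsection \<open>Lebesgue measure and normal distributions on vectors\<close>

text \<open>Points of the product space are \<open>undefined\<close> outside the index set, so a
  vector determines its preimage there.\<close>

lemma inj_on_vec: "inj_on (vec n) (space (\<Pi>\<^sub>M i\<in>{..<n}. lborel :: real measure))"
proof (rule inj_onI)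
  fix x y :: "nat \<Rightarrow> real"
  assume *: "x \<in> space (\<Pi>\<^sub>M i\<in>{..<n}. lborel)" "y \<in> space (\<Pi>\<^sub>M i\<in>{..<n}. lborel)" "vec n x = vec n y"
  have "x i = y i" if "i < n" for i
    using arg_cong[OF *(3), of "\<lambda>v. v $ i"] that by simp
  then show "x = y" using *(1,2) by (auto simp: space_PiM intro: PiE_ext)
qed

lemma space_lborel_vec [simp]: "space (lborel_vec n) = carrier_vec n"
proof -
  have "v \<in> vec n ` (\<Pi>\<^sub>E i\<in>{..<n}. UNIV)" if "v \<in> carrier_vec n" for v :: "real vec"
    using that by (intro image_eqI[of _ _ "restrict (\<lambda>i. v $ i) {..<n}"]) auto
  then show ?thesis
    unfolding lborel_vec_def space_embed_measure by (auto simp: space_PiM)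
qed

lemma measurable_vec: "vec n \<in> measurable (\<Pi>\<^sub>M i\<in>{..<n}. lborel) (lborel_vec n)"
  unfolding lborel_vec_def by (rule measurable_embed_measure2'[OF inj_on_vec])

lemma nn_integral_lborel_vec:
  "f \<in> borel_measurable (lborel_vec n) \<Longrightarrow>
    (\<integral>\<^sup>+x. f x \<partial>lborel_vec n) = (\<integral>\<^sup>+x. f (vec n x) \<partial>(\<Pi>\<^sub>M i\<in>{..<n}. lborel))"
  unfolding lborel_vec_def by (rule nn_integral_embed_measure'[OF inj_on_vec])

section \<open>Coordinatewise measurability of vector operations\<close>

lemma measurable_vec_index: "i < n \<Longrightarrow> (\<lambda>x. x $ i) \<in> borel_measurable (lborel_vec n)"
  unfolding lborel_vec_def
  using measurable_component_singleton[of i "{..<n}" "\<lambda>_. lborel :: real measure"]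
  by (intro measurable_embed_measure1) simp

lemma measurable_lborel_vecI:
  assumes "\<And>x. x \<in> space N \<Longrightarrow> f x \<in> carrier_vec n"
    and "\<And>i. i < n \<Longrightarrow> (\<lambda>x. f x $ i) \<in> borel_measurable N"
  shows "f \<in> measurable N (lborel_vec n)"
proof -
  have "(\<lambda>x. restrict (\<lambda>i. f x $ i) {..<n}) \<in> measurable N (\<Pi>\<^sub>M i\<in>{..<n}. lborel)"
    using assms(2) by (intro measurable_restrict) simp
  from measurable_compose[OF this measurable_vec]
  have "(\<lambda>x. vec n (restrict (\<lambda>i. f x $ i) {..<n})) \<in> measurable N (lborel_vec n)" .
  moreover have "vec n (restrict (\<lambda>i. f x $ i) {..<n}) = f x" if "x \<in> space N" for x
    using assms(1)[OF that] by auto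
  ultimately show ?thesis by (simp cong: measurable_cong)
qed

lemma measurable_lborel_vec_index:
  assumes "f \<in> measurable N (lborel_vec n)" "i < n"
  shows "(\<lambda>x. f x $ i) \<in> borel_measurable N"
  using measurable_compose[OF assms(1) measurable_vec_index[OF assms(2)]] .

lemma measurable_lborel_vec_carrier:
  "f \<in> measurable N (lborel_vec n) \<Longrightarrow> x \<in> space N \<Longrightarrow> f x \<in> carrier_vec n"
  using measurable_space[of f N "lborel_vec n" x] by simp

lemma measurable_scalar_prod:
  assumes "f \<in> measurable N (lborel_vec n)" "g \<in> measurable N (lborel_vec n)"
  shows "(\<lambda>x. f x \<bullet> g x) \<in> borel_measurable N"
proof -
  have "(\<lambda>x. \<Sum>i<n. f x $ i * g x $ i) \<in> borel_measurable N"
    using assms by (intro borel_measurable_sum borel_measurable_times measurable_lborel_vec_index) auto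
  moreover have "f x \<bullet> g x = (\<Sum>i<n. f x $ i * g x $ i)" if "x \<in> space N" for x
    using measurable_lborel_vec_carrier[OF assms(2) that]
    by (simp add: scalar_prod_def atLeast0LessThan)
  ultimately show ?thesis by (simp cong: measurable_cong)
qed

lemma measurable_const_vec: "c \<in> carrier_vec n \<Longrightarrow> (\<lambda>x. c) \<in> measurable N (lborel_vec n)"
  by simp

lemma measurable_mult_mat_vec:
  assumes "A \<in> carrier_mat m n" "f \<in> measurable N (lborel_vec n)"
  shows "(\<lambda>x. A *\<^sub>v f x) \<in> measurable N (lborel_vec m)"
proof (rule measurable_lborel_vecI)
  fix i assume i: "i < m"
  have "(\<lambda>x. row A i \<bullet> f x) \<in> borel_measurable N"
    using assms i by (intro measurable_scalar_prod[of _ _ n] measurable_const_vec) auto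
  then show "(\<lambda>x. (A *\<^sub>v f x) $ i) \<in> borel_measurable N"
    using assms i by simp
qed (use assms measurable_lborel_vec_carrier[OF assms(2)] in auto)

lemma measurable_minus_vec:
  assumes "f \<in> measurable N (lborel_vec n)" "g \<in> measurable N (lborel_vec n)"
  shows "(\<lambda>x. f x - g x) \<in> measurable N (lborel_vec n)"
proof (rule measurable_lborel_vecI)
  fix i assume i: "i < n"
  have "(\<lambda>x. f x $ i - g x $ i) \<in> borel_measurable N"
    using assms i by (intro borel_measurable_diff measurable_lborel_vec_index) auto
  moreover have "(f x - g x) $ i = f x $ i - g x $ i" if "x \<in> space N" for x
    using measurable_lborel_vec_carrier[OF assms(2) that] i by simp
  ultimately show "(\<lambda>x. (f x - g x) $ i) \<in> borel_measurable N"
    by (simp cong: measurable_cong)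
qed (use measurable_lborel_vec_carrier[OF assms(1)] measurable_lborel_vec_carrier[OF assms(2)] in auto)

lemmas measurable_vec_intros = measurable_scalar_prod measurable_const_vec
  measurable_mult_mat_vec measurable_minus_vec

lemma measurable_pad_zeros:
  assumes "S \<subseteq> {..<p}"
  shows "pad_zeros p S \<in> measurable (lborel_vec (card S)) (lborel_vec p)"
proof (rule measurable_lborel_vecI)
  fix j assume j: "j < p"
  show "(\<lambda>b. pad_zeros p S b $ j) \<in> borel_measurable (lborel_vec (card S))"
  proof (cases "j \<in> S")
    case True
    have "finite S" using assms finite_subset by blast
    then have "card {i \<in> S. i < j} < card S"
      using True by (intro psubset_card_mono) auto
    then show ?thesis using True j by (simp add: pad_zeros_def measurable_vec_index)
  next
    case False
    then show ?thesis using j by (simp add: pad_zeros_def)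
  qed
qed (simp add: pad_zeros_def)

section \<open>Positive definite matrices and their inverses\<close>

lemma smult_mat_mult_vec:
  fixes A :: "real mat"
  assumes "A \<in> carrier_mat nr nc" "v \<in> carrier_vec nc"
  shows "(r \<cdot>\<^sub>m A) *\<^sub>v v = r \<cdot>\<^sub>v (A *\<^sub>v v)"
  using assms
  by (intro eq_vecI) (auto simp: scalar_prod_def sum_distrib_left ac_simps intro!: sum.cong)

text \<open>Symmetry is included because a quadratic form alone does not determine its matrix,
  whereas the Gaussian integral is expressed by the determinant.\<close>

definition spd :: "nat \<Rightarrow> real mat \<Rightarrow> bool" where
  "spd n A \<longleftrightarrow> A \<in> carrier_mat n n \<and> transpose_mat A = A
     \<and> (\<forall>x\<in>carrier_vec n. x \<noteq> 0\<^sub>v n \<longrightarrow> x \<bullet> (A *\<^sub>v x) > 0)"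

lemma transpose_mat_smult: "transpose_mat (r \<cdot>\<^sub>m A) = r \<cdot>\<^sub>m transpose_mat A"
  by (intro eq_matI) auto

lemma spd_smult: "spd n A \<Longrightarrow> r > 0 \<Longrightarrow> spd n (r \<cdot>\<^sub>m A)"
  unfolding spd_def by (auto simp: smult_mat_mult_vec[of A n n] transpose_mat_smult)

lemma spd_one: "spd n (1\<^sub>m n)"
proof -
  have "x \<bullet> x > 0" if x: "x \<in> carrier_vec n" "x \<noteq> 0\<^sub>v n" for x :: "real vec"
  proof -
    obtain i where "i < n" "x $ i \<noteq> 0"
      using x by (metis carrier_vecD eq_vecI index_zero_vec)
    then have "(\<Sum>i<n. x $ i * x $ i) > 0"
      by (intro sum_pos2[of _ i]) (auto simp: zero_less_mult_iff)
    then show ?thesis using x by (simp add: scalar_prod_def atLeast0LessThan)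
  qed
  then show ?thesis by (auto simp: spd_def)
qed

lemma
  assumes "spd n A" "\<mu> \<in> carrier_vec n"
  shows det_spd_pos: "det A > 0"
    and nn_integral_gaussian: "(\<integral>\<^sup>+x. ennreal (exp (- ((x - \<mu>) \<bullet> (A *\<^sub>v (x - \<mu>))) / 2)) \<partial>lborel_vec n)
      = ennreal (sqrt ((2 * pi) ^ n / det A))"
proof -
  have A: "A \<in> carrier_mat n n" using assms by (simp add: spd_def)
  have sym: "A $$ (i,j) = A $$ (j,i)" if "i < n" "j < n" for i j
    using assms(1) that A unfolding spd_def by (metis carrier_matD index_transpose_mat(1))
  have pos: "(\<Sum>i<n. \<Sum>j<n. A $$ (i,j) * x i * x j) > 0" if "\<exists>i<n. x i \<noteq> 0" for x
  proof -
    have "vec n x \<noteq> 0\<^sub>v n" using that by (metis index_vec index_zero_vec(1))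
    then have "vec n x \<bullet> (A *\<^sub>v vec n x) > 0"
      using assms(1) unfolding spd_def by auto
    then show ?thesis
      by (subst (asm) scalar_prod_mult_mat_vec_eq_sum[OF A]) auto
  qed
  note * = nn_integral_gaussian_PiM[OF A sym pos, of "\<lambda>i. \<mu> $ i"]
  show "det A > 0" using * by simp
  have "(\<integral>\<^sup>+x. ennreal (exp (- ((x - \<mu>) \<bullet> (A *\<^sub>v (x - \<mu>))) / 2)) \<partial>lborel_vec n)
    = (\<integral>\<^sup>+x. ennreal (exp (- ((vec n x - \<mu>) \<bullet> (A *\<^sub>v (vec n x - \<mu>))) / 2)) \<partial>(\<Pi>\<^sub>M i\<in>{..<n}. lborel))"
  proof (rule nn_integral_lborel_vec)
    have "(\<lambda>x. (x - \<mu>) \<bullet> (A *\<^sub>v (x - \<mu>))) \<in> borel_measurable (lborel_vec n)"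
      using A assms(2) by (intro measurable_vec_intros) auto
    then show "(\<lambda>x. ennreal (exp (- ((x - \<mu>) \<bullet> (A *\<^sub>v (x - \<mu>))) / 2))) \<in> borel_measurable (lborel_vec n)"
      by simp
  qed
  also have "\<dots> = ennreal (sqrt ((2 * pi) ^ n / det A))"
    using * assms(2) A by (simp add: scalar_prod_mult_mat_vec_eq_sum[OF A])
  finally show "(\<integral>\<^sup>+x. ennreal (exp (- ((x - \<mu>) \<bullet> (A *\<^sub>v (x - \<mu>))) / 2)) \<partial>lborel_vec n)
      = ennreal (sqrt ((2 * pi) ^ n / det A))" .
qed

text \<open>\<open>mat_inv\<close> takes \<open>the\<close> of an option. The two equations make
  \<open>A\<close> a unit of the matrix ring, so \<open>mat_inverse\<close> succeeds, and two-sided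
  inverses are unique.\<close>

lemma mat_inv_unique:
  fixes A :: "real mat"
  assumes A: "A \<in> carrier_mat n n" and B: "B \<in> carrier_mat n n"
    and AB: "A * B = 1\<^sub>m n" and BA: "B * A = 1\<^sub>m n"
  shows "mat_inv A = B"
proof -
  have "A \<in> Units (ring_mat TYPE(real) n ())"
    using assms by (auto simp: Units_def ring_mat_def)
  then obtain C where C: "mat_inverse A = Some C"
    using mat_inverse(1)[OF A, of "()"] by (cases "mat_inverse A") auto
  from mat_inverse(2)[OF A C] have *: "C * A = 1\<^sub>m n" "C \<in> carrier_mat n n" by auto
  have "C = C * (A * B)" using AB * by simp
  also have "\<dots> = B" using * A B by (simp add: assoc_mult_mat[symmetric])
  finally show ?thesis using C by (simp add: mat_inv_def)
qed

lemma mat_inv_inverse: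
  fixes A :: "real mat"
  assumes A: "A \<in> carrier_mat n n" and "invertible_mat A"
  shows "mat_inv A \<in> carrier_mat n n" "A * mat_inv A = 1\<^sub>m n" "mat_inv A * A = 1\<^sub>m n"
proof -
  obtain B where "inverts_mat A B" "inverts_mat B A"
    using assms(2) by (auto simp: invertible_mat_def)
  then have AB: "A * B = 1\<^sub>m n" and BA: "B * A = 1\<^sub>m (dim_row B)"
    using A by (auto simp: inverts_mat_def)
  \<comment> \<open>\<open>inverts_mat\<close> leaves the shape of the inverse open; comparing
    dimensions in the two equations fixes it.\<close>
  have "dim_col B = n" using arg_cong[OF AB, of dim_col] by simp
  moreover have "dim_row B = n" using arg_cong[OF BA, of dim_col] A by simp
  ultimately have B: "B \<in> carrier_mat n n" and BA': "B * A = 1\<^sub>m n" using BA by auto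
  have "mat_inv A = B" by (rule mat_inv_unique[OF A B AB BA'])
  then show "mat_inv A \<in> carrier_mat n n" "A * mat_inv A = 1\<^sub>m n" "mat_inv A * A = 1\<^sub>m n"
    using B AB BA' by auto
qed

section \<open>Integrals against multivariate normal distributions\<close>

lemma measurable_mvn_density:
  assumes "mat_inv \<Sigma> \<in> carrier_mat n n" "\<mu> \<in> carrier_vec n"
  shows "mvn_density \<mu> \<Sigma> \<in> borel_measurable (lborel_vec n)"
proof -
  have "(\<lambda>x. (x - \<mu>) \<bullet> (mat_inv \<Sigma> *\<^sub>v (x - \<mu>))) \<in> borel_measurable (lborel_vec n)"
    using assms by (intro measurable_vec_intros) auto
  then show ?thesis unfolding mvn_density_def[abs_def] by simp
qed

lemma nn_integral_mvn:
  assumes "mat_inv \<Sigma> \<in> carrier_mat n n" "\<mu> \<in> carrier_vec n" "f \<in> borel_measurable (lborel_vec n)"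
  shows "(\<integral>\<^sup>+x. f x \<partial>mvn \<mu> \<Sigma>) = (\<integral>\<^sup>+x. ennreal (mvn_density \<mu> \<Sigma> x) * f x \<partial>lborel_vec n)"
  using assms measurable_mvn_density[OF assms(1,2)]
  by (simp add: mvn_def nn_integral_density)

text \<open>The Mahalanobis form is a chi-square variable with \<open>n\<close> degrees of freedom,
  and this is its Laplace transform: the integrand changes the precision from \<open>A\<close> to
  \<open>(1 + \<delta>) \<cdot>\<^sub>m A\<close>, and \<open>det A\<close> cancels. The value at 0
  says that the distribution is normalised.\<close>

lemma nn_integral_mvn_exp_mahalanobis:
  assumes \<Sigma>: "\<Sigma> \<in> carrier_mat n n" and A: "spd n A" and inv: "\<Sigma> * A = 1\<^sub>m n" "A * \<Sigma> = 1\<^sub>m n"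
    and \<mu>: "\<mu> \<in> carrier_vec n" and \<delta>: "\<delta> \<ge> 0"
  shows "(\<integral>\<^sup>+x. ennreal (exp (- \<delta> * ((x - \<mu>) \<bullet> (A *\<^sub>v (x - \<mu>))) / 2)) \<partial>mvn \<mu> \<Sigma>)
    = ennreal (sqrt (1 / (1 + \<delta>) ^ n))"
proof -
  have Ac: "A \<in> carrier_mat n n" using A by (simp add: spd_def)
  have mi: "mat_inv \<Sigma> = A" by (rule mat_inv_unique[OF \<Sigma> Ac inv])
  have dA: "det A > 0" using det_spd_pos[OF A \<mu>] .
  have "det \<Sigma> * det A = 1" using det_mult[OF \<Sigma> Ac] inv by simp
  then have d\<Sigma>: "det \<Sigma> = 1 / det A" using dA by (simp add: field_simps)
  let ?c = "sqrt ((2 * pi) ^ n / det A)"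
  have c: "?c > 0" using dA by simp
  have meas: "(\<lambda>x. (x - \<mu>) \<bullet> (B *\<^sub>v (x - \<mu>))) \<in> borel_measurable (lborel_vec n)" 
    if "B \<in> carrier_mat n n" for B
    using that \<mu> by (intro measurable_vec_intros) auto
  have "(\<integral>\<^sup>+x. ennreal (exp (- \<delta> * ((x - \<mu>) \<bullet> (A *\<^sub>v (x - \<mu>))) / 2)) \<partial>mvn \<mu> \<Sigma>)
    = (\<integral>\<^sup>+x. ennreal (mvn_density \<mu> \<Sigma> x) * ennreal (exp (- \<delta> * ((x - \<mu>) \<bullet> (A *\<^sub>v (x - \<mu>))) / 2)) \<partial>lborel_vec n)"
    using meas[OF Ac] by (intro nn_integral_mvn) (auto simp: mi Ac \<mu>)
  also have "\<dots> = (\<integral>\<^sup>+x. ennreal (1 / ?c) * ennreal (exp (- ((x - \<mu>) \<bullet> (((1 + \<delta>) \<cdot>\<^sub>m A) *\<^sub>v (x - \<mu>))) / 2)) \<partial>lborel_vec n)"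
  proof (rule nn_integral_cong)
    fix x assume "x \<in> space (lborel_vec n)"
    then have x: "x - \<mu> \<in> carrier_vec n" using \<mu> by simp
    have eq: "(x - \<mu>) \<bullet> (((1 + \<delta>) \<cdot>\<^sub>m A) *\<^sub>v (x - \<mu>)) = (1 + \<delta>) * ((x - \<mu>) \<bullet> (A *\<^sub>v (x - \<mu>)))"
      using x Ac by (simp add: smult_mat_mult_vec[of A n n])
    have den: "mvn_density \<mu> \<Sigma> x = 1 / ?c * exp (- ((x - \<mu>) \<bullet> (A *\<^sub>v (x - \<mu>))) / 2)"
      using \<mu> by (simp add: mvn_density_def mi d\<Sigma> )
    show "ennreal (mvn_density \<mu> \<Sigma> x) * ennreal (exp (- \<delta> * ((x - \<mu>) \<bullet> (A *\<^sub>v (x - \<mu>))) / 2))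
      = ennreal (1 / ?c) * ennreal (exp (- ((x - \<mu>) \<bullet> (((1 + \<delta>) \<cdot>\<^sub>m A) *\<^sub>v (x - \<mu>))) / 2))"
      unfolding eq den using c
      by (simp add: ennreal_mult'[symmetric] exp_add[symmetric] algebra_simps add_divide_distrib)
  qed
  also have "\<dots> = ennreal (1 / ?c) * ennreal (sqrt ((2 * pi) ^ n / det ((1 + \<delta>) \<cdot>\<^sub>m A)))"
    using nn_integral_gaussian[OF spd_smult[OF A, of "1 + \<delta>"] \<mu>] \<delta> meas[of "(1 + \<delta>) \<cdot>\<^sub>m A"] Ac
    by (subst nn_integral_cmult) auto
  also have "\<dots> = ennreal (sqrt (1 / (1 + \<delta>) ^ n))"
    using dA \<delta> c Ac
    by (subst ennreal_mult'[symmetric]) (auto simp: real_sqrt_mult real_sqrt_divide field_simps)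
  finally show ?thesis .
qed

subsection \<open>Least squares projections\<close>

lemma spd_pos: "spd n A \<Longrightarrow> x \<in> carrier_vec n \<Longrightarrow> x \<noteq> 0\<^sub>v n \<Longrightarrow> x \<bullet> (A *\<^sub>v x) > 0"
  by (simp add: spd_def)

text \<open>Sylvester's determinant identity. Multiplying \<open>?M\<close> by \<open>?L\<close> or
  by \<open>?R\<close>, both of determinant 1, clears its lower left or its upper right block, and
  the resulting triangular products have the two sides as determinants.\<close>

lemma det_one_minus_mult_swap:
  fixes U V :: "real mat"
  assumes U: "U \<in> carrier_mat n k" and V: "V \<in> carrier_mat k n"
  shows "det (1\<^sub>m n - U * V) = det (1\<^sub>m k - V * U)"
proof -
  let ?M = "four_block_mat (1\<^sub>m n) U V (1\<^sub>m k)"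
  let ?L = "four_block_mat (1\<^sub>m n) (0\<^sub>m n k) (- V) (1\<^sub>m k)"
  let ?R = "four_block_mat (1\<^sub>m n) (- U) (0\<^sub>m k n) (1\<^sub>m k)"
  have UV: "U * V \<in> carrier_mat n n" "V * U \<in> carrier_mat k k" using U V by auto
  have "?M * ?L = four_block_mat (1\<^sub>m n * 1\<^sub>m n + U * - V) (1\<^sub>m n * 0\<^sub>m n k + U * 1\<^sub>m k)
      (V * 1\<^sub>m n + 1\<^sub>m k * - V) (V * 0\<^sub>m n k + 1\<^sub>m k * 1\<^sub>m k)"
    using U V by (intro mult_four_block_mat) auto
  also have "1\<^sub>m n * 1\<^sub>m n + U * - V = 1\<^sub>m n - U * V"
    using U V UV minus_add_uminus_mat[of "1\<^sub>m n" n n "U * V"] by simp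
  also have "V * 1\<^sub>m n + 1\<^sub>m k * - V = 0\<^sub>m k n"
    using U V by (intro eq_matI) auto
  also have "1\<^sub>m n * 0\<^sub>m n k + U * 1\<^sub>m k = U" using U by simp
  also have "V * 0\<^sub>m n k + 1\<^sub>m k * 1\<^sub>m k = 1\<^sub>m k" using V by simp
  finally have "det (?M * ?L) = det (1\<^sub>m n - U * V) * det (1\<^sub>m k :: real mat)"
    using det_four_block_mat_lower_left_zero[of "1\<^sub>m n - U * V" n U k "0\<^sub>m k n" "1\<^sub>m k"]
      U minus_carrier_mat[OF UV(1)] by simp
  then have L: "det ?M * det ?L = det (1\<^sub>m n - U * V)"
    using det_mult[of ?M "n + k" ?L] by simp
  have "?M * ?R = four_block_mat (1\<^sub>m n * 1\<^sub>m n + U * 0\<^sub>m k n) (1\<^sub>m n * - U + U * 1\<^sub>m k)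
      (V * 1\<^sub>m n + 1\<^sub>m k * 0\<^sub>m k n) (V * - U + 1\<^sub>m k * 1\<^sub>m k)"
    using U V by (intro mult_four_block_mat) auto
  also have "V * - U + 1\<^sub>m k * 1\<^sub>m k = 1\<^sub>m k - V * U"
    using U V UV minus_add_uminus_mat[of "1\<^sub>m k" k k "V * U"] comm_add_mat[of "- (V * U)" k k "1\<^sub>m k"] by simp
  also have "1\<^sub>m n * - U + U * 1\<^sub>m k = 0\<^sub>m n k"
    using U V by (intro eq_matI) auto
  also have "1\<^sub>m n * 1\<^sub>m n + U * 0\<^sub>m k n = 1\<^sub>m n" using U by simp
  also have "V * 1\<^sub>m n + 1\<^sub>m k * 0\<^sub>m k n = V" using V by simp
  finally have "det (?M * ?R) = det (1\<^sub>m n :: real mat) * det (1\<^sub>m k - V * U)"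
    using det_four_block_mat_upper_right_zero[of "1\<^sub>m n" n "0\<^sub>m n k" k V "1\<^sub>m k - V * U"]
      V minus_carrier_mat[OF UV(2)] by simp
  then have R: "det ?M * det ?R = det (1\<^sub>m k - V * U)"
    using det_mult[of ?M "n + k" ?R] by simp
  have "det ?L = 1" "det ?R = 1"
    using U V det_four_block_mat_upper_right_zero[of "1\<^sub>m n" n "0\<^sub>m n k" k "- V" "1\<^sub>m k"]
      det_four_block_mat_lower_left_zero[of "1\<^sub>m n" n "- U" k "0\<^sub>m k n" "1\<^sub>m k"] by auto
  with L R show ?thesis by simp
qed

lemma scalar_prod_self_minus:
  fixes a b :: "real vec"
  assumes "a \<in> carrier_vec n" "b \<in> carrier_vec n"
  shows "(a - b) \<bullet> (a - b) = a \<bullet> a - 2 * (a \<bullet> b) + b \<bullet> b"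
  using assms comm_scalar_prod[OF assms]
  by (simp add: scalar_prod_minus_distrib[of _ n] minus_scalar_prod_distrib[of _ n])

lemma scalar_prod_self_add:
  fixes a b :: "real vec"
  assumes "a \<in> carrier_vec n" "b \<in> carrier_vec n"
  shows "(a + b) \<bullet> (a + b) = a \<bullet> a + 2 * (a \<bullet> b) + b \<bullet> b"
  using assms comm_scalar_prod[OF assms]
  by (simp add: scalar_prod_add_distrib[of _ n] add_scalar_prod_distrib[of _ n])

lemma scalar_prod_self_nonneg: "(v :: real vec) \<bullet> v \<ge> 0"
  by (simp add: scalar_prod_def sum_nonneg)

text \<open>Column selection is abstracted away: \<open>U\<close> stands for the columns of a model,
  and the invertible Gram matrix expresses their linear independence.\<close>

locale full_rank_design =
  fixes U :: "real mat" and n k :: nat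
  assumes U: "U \<in> carrier_mat n k"
    and invertible_gram: "invertible_mat (transpose_mat U * U)"
begin

definition "G = transpose_mat U * U"
definition "H = mat_inv G"
text \<open>The bracketing exhibits \<open>P\<close> as an n by k matrix times a k by n matrix, the
  shape to which Sylvester's identity applies.\<close>

definition "P = U * (H * transpose_mat U)"
definition "coef y = H *\<^sub>v (transpose_mat U *\<^sub>v y)"

lemma G: "G \<in> carrier_mat k k" using U by (simp add: G_def)

lemma H: "H \<in> carrier_mat k k" and GH: "G * H = 1\<^sub>m k" and HG: "H * G = 1\<^sub>m k"
  using mat_inv_inverse[OF G] invertible_gram by (auto simp: H_def G_def)

lemma P: "P \<in> carrier_mat n n" using U H by (auto simp: P_def)

lemma coef: "y \<in> carrier_vec n \<Longrightarrow> coef y \<in> carrier_vec k"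
  unfolding coef_def using U H by (intro mult_mat_vec_carrier) auto

lemma transpose_G: "transpose_mat G = G"
  using U by (simp add: G_def transpose_mult[of _ k n _ k])

lemma transpose_H: "transpose_mat H = H"
proof -
  have "G * transpose_mat H = 1\<^sub>m k"
    using arg_cong[OF HG, of transpose_mat] G H by (simp add: transpose_mult[of _ k k _ k] transpose_G)
  moreover have "transpose_mat H * G = 1\<^sub>m k"
    using arg_cong[OF GH, of transpose_mat] G H by (simp add: transpose_mult[of _ k k _ k] transpose_G)
  ultimately show ?thesis
    using mat_inv_unique[OF G, of "transpose_mat H"] H by (simp add: H_def)
qed

lemma transpose_P: "transpose_mat P = P"
  using U H unfolding P_def
  by (simp add: transpose_mult[of _ n k _ n] transpose_mult[of _ k k _ n] transpose_H assoc_mult_mat[of _ n k _ k _ n])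

lemma scalar_prod_G: "b \<in> carrier_vec k \<Longrightarrow> b \<bullet> (G *\<^sub>v b) = (U *\<^sub>v b) \<bullet> (U *\<^sub>v b)"
proof -
  assume b: "b \<in> carrier_vec k"
  have "b \<bullet> (G *\<^sub>v b) = b \<bullet> (transpose_mat U *\<^sub>v (U *\<^sub>v b))"
    using U b by (simp add: G_def assoc_mult_mat_vec[of _ k n _ k])
  also have "\<dots> = (transpose_mat U *\<^sub>v (U *\<^sub>v b)) \<bullet> b"
    using U b by (intro comm_scalar_prod[of _ k]) auto
  also have "\<dots> = (U *\<^sub>v b) \<bullet> (U *\<^sub>v b)"
    using U b by (intro transpose_vec_mult_scalar) auto
  finally show ?thesis .
qed

text \<open>The form is the squared norm of \<open>U *\<^sub>v b\<close>. Where it vanishes,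
  \<open>G\<close> annihilates \<open>b\<close> as well, and applying \<open>H\<close> recovers
  \<open>b\<close>, which is therefore zero.\<close>

lemma spd_G: "spd k G"
proof -
  have "b \<bullet> (G *\<^sub>v b) > 0" if b: "b \<in> carrier_vec k" "b \<noteq> 0\<^sub>v k" for b
  proof (rule ccontr)
    assume "\<not> b \<bullet> (G *\<^sub>v b) > 0"
    then have *: "(U *\<^sub>v b) \<bullet> (U *\<^sub>v b) \<le> 0" using scalar_prod_G[OF b(1)] by simp
    have "U *\<^sub>v b = 0\<^sub>v n"
    proof (rule ccontr)
      assume "U *\<^sub>v b \<noteq> 0\<^sub>v n"
      then have "(U *\<^sub>v b) \<bullet> (1\<^sub>m n *\<^sub>v (U *\<^sub>v b)) > 0"
        using U b by (intro spd_pos[OF spd_one]) auto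
      then show False using * U b by simp
    qed
    then have "G *\<^sub>v b = 0\<^sub>v k"
      using U b by (simp add: G_def assoc_mult_mat_vec[of _ k n _ k]) (auto simp: scalar_prod_def)
    then have "H *\<^sub>v (G *\<^sub>v b) = 0\<^sub>v k" using H by (auto simp: scalar_prod_def)
    moreover have "H *\<^sub>v (G *\<^sub>v b) = b"
      using b H G HG by (simp add: assoc_mult_mat_vec[of _ k k _ k, symmetric])
    ultimately show False using b by simp
  qed
  then show ?thesis using G transpose_G by (auto simp: spd_def)
qed

lemma U_coef: "y \<in> carrier_vec n \<Longrightarrow> U *\<^sub>v coef y = P *\<^sub>v y"
  using U H by (simp add: coef_def P_def assoc_mult_mat_vec[of _ n k _ n] assoc_mult_mat_vec[of _ k k _ n])

lemma P_U: "b \<in> carrier_vec k \<Longrightarrow> P *\<^sub>v (U *\<^sub>v b) = U *\<^sub>v b"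
proof -
  assume b: "b \<in> carrier_vec k"
  have "H *\<^sub>v (transpose_mat U *\<^sub>v (U *\<^sub>v b)) = H *\<^sub>v (G *\<^sub>v b)"
    using U b by (simp add: G_def assoc_mult_mat_vec[of _ k n _ k])
  also have "\<dots> = b" using b H G HG by (simp add: assoc_mult_mat_vec[of _ k k _ k, symmetric])
  finally have "coef (U *\<^sub>v b) = b" by (simp add: coef_def)
  then show ?thesis using U_coef[of "U *\<^sub>v b"] U b by simp
qed

lemma P_P: "y \<in> carrier_vec n \<Longrightarrow> P *\<^sub>v (P *\<^sub>v y) = P *\<^sub>v y"
  using P_U[OF coef] U_coef by simp

lemma P_self_adjoint:
  "a \<in> carrier_vec n \<Longrightarrow> b \<in> carrier_vec n \<Longrightarrow> (P *\<^sub>v a) \<bullet> b = a \<bullet> (P *\<^sub>v b)"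
  using transpose_vec_mult_scalar[OF P, of b a] by (simp add: transpose_P)

lemma P_orthogonal:
  assumes "a \<in> carrier_vec n" "b \<in> carrier_vec n"
  shows "(a - P *\<^sub>v a) \<bullet> (P *\<^sub>v b) = 0"
proof -
  have "(P *\<^sub>v a) \<bullet> (P *\<^sub>v b) = a \<bullet> (P *\<^sub>v b)"
    using assms P P_self_adjoint[of a "P *\<^sub>v b"] by (simp add: P_P)
  then show ?thesis using assms P by (simp add: minus_scalar_prod_distrib[of _ n])
qed

text \<open>Pythagoras: the least squares residual is orthogonal to the column space. As a function
  of \<open>b\<close> the likelihood is thus centred at \<open>coef y\<close>, exactly where the
  prior component is centred.\<close>

lemma residual_decomp:
  assumes y: "y \<in> carrier_vec n" and b: "b \<in> carrier_vec k"
  shows "(y - U *\<^sub>v b) \<bullet> (y - U *\<^sub>v b) =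
    (y - P *\<^sub>v y) \<bullet> (y - P *\<^sub>v y) + (b - coef y) \<bullet> (G *\<^sub>v (b - coef y))"
proof -
  have *: "U *\<^sub>v (b - coef y) = U *\<^sub>v b - P *\<^sub>v y"
    using U b coef[OF y] y by (simp add: mult_minus_distrib_mat_vec[of _ n k] U_coef)
  have "y - U *\<^sub>v b = (y - P *\<^sub>v y) - U *\<^sub>v (b - coef y)"
    unfolding * using y b U P by auto
  moreover have "(y - P *\<^sub>v y) \<bullet> (U *\<^sub>v (b - coef y)) = 0"
    using P_orthogonal[OF y, of "U *\<^sub>v (b - coef y)"] P_U[of "b - coef y"] U b coef[OF y] by simp
  ultimately show ?thesis
    using scalar_prod_self_minus[of "y - P *\<^sub>v y" n "U *\<^sub>v (b - coef y)"] P U y b coef[OF y]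
    by (simp add: scalar_prod_G)
qed

text \<open>The error is made of the coefficient deviation \<open>?u\<close>, the projected noise
  \<open>?v\<close> and the bias \<open>?w\<close>. The bias is orthogonal to the column space and
  enters exactly; the other two lie in it and need not be orthogonal to each other, whence the
  factors 2.\<close>

lemma prediction_error_le:
  assumes y: "y \<in> carrier_vec n" and \<mu>: "\<mu> \<in> carrier_vec n" and b: "b \<in> carrier_vec k"
  shows "(U *\<^sub>v b - \<mu>) \<bullet> (U *\<^sub>v b - \<mu>) \<le>
    (\<mu> - P *\<^sub>v \<mu>) \<bullet> (\<mu> - P *\<^sub>v \<mu>)
    + 2 * ((b - coef y) \<bullet> (G *\<^sub>v (b - coef y)))
    + 2 * ((P *\<^sub>v (y - \<mu>)) \<bullet> (P *\<^sub>v (y - \<mu>)))"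
proof -
  let ?w = "\<mu> - P *\<^sub>v \<mu>" and ?u = "U *\<^sub>v (b - coef y)" and ?v = "P *\<^sub>v (y - \<mu>)"
  have w: "?w \<in> carrier_vec n" and u: "?u \<in> carrier_vec n" and v: "?v \<in> carrier_vec n"
    using \<mu> y b U P coef[OF y] by auto
  have *: "?u = U *\<^sub>v b - P *\<^sub>v y"
    using U b coef[OF y] y by (simp add: mult_minus_distrib_mat_vec[of _ n k] U_coef)
  have v': "?v = P *\<^sub>v y - P *\<^sub>v \<mu>" using P y \<mu> by (simp add: mult_minus_distrib_mat_vec[of _ n n])
  have "U *\<^sub>v b - \<mu> = (?u + ?v) - ?w"
    unfolding * v' using y b U P \<mu> by auto
  moreover have "?u + ?v = P *\<^sub>v (?u + ?v)"
    using u v P P_U[of "b - coef y"] P_P[of "y - \<mu>"] b coef[OF y] y \<mu>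
    by (simp add: mult_add_distrib_mat_vec[of _ n n])
  then have "(?u + ?v) \<bullet> ?w = 0"
    using P_orthogonal[OF \<mu>, of "?u + ?v"] comm_scalar_prod[of "?u + ?v" n ?w] u v w by simp
  ultimately have "(U *\<^sub>v b - \<mu>) \<bullet> (U *\<^sub>v b - \<mu>) = (?u + ?v) \<bullet> (?u + ?v) + ?w \<bullet> ?w"
    using scalar_prod_self_minus[of "?u + ?v" n ?w] u v w by simp
  moreover have "(?u + ?v) \<bullet> (?u + ?v) \<le> 2 * (?u \<bullet> ?u) + 2 * (?v \<bullet> ?v)"
    using scalar_prod_self_add[OF u v] scalar_prod_self_minus[OF u v] scalar_prod_self_nonneg[of "?u - ?v"]
    by simp
  ultimately show ?thesis using scalar_prod_G[of "b - coef y"] b coef[OF y] by simp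
qed

text \<open>Sylvester's identity moves the computation to dimension \<open>k\<close>, where the
  projection becomes the identity. This is what keeps \<open>n\<close> out of the cost of a
  model.\<close>

lemma det_one_minus_P: "det (1\<^sub>m n - l \<cdot>\<^sub>m P) = (1 - l) ^ k"
proof -
  have V: "H * transpose_mat U \<in> carrier_mat k n" using U H by auto
  have "l \<cdot>\<^sub>m P = (l \<cdot>\<^sub>m U) * (H * transpose_mat U)"
    unfolding P_def using U V by (simp add: mult_smult_assoc_mat[of _ n k _ n])
  then have "det (1\<^sub>m n - l \<cdot>\<^sub>m P) = det (1\<^sub>m k - (H * transpose_mat U) * (l \<cdot>\<^sub>m U))"
    using U V det_one_minus_mult_swap[of "l \<cdot>\<^sub>m U" n k "H * transpose_mat U"] by simp
  also have "(H * transpose_mat U) * (l \<cdot>\<^sub>m U) = l \<cdot>\<^sub>m 1\<^sub>m k"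
    using U V H HG by (simp add: mult_smult_distrib[of _ k n] assoc_mult_mat[of _ k k _ n _ k] G_def)
  also have "1\<^sub>m k - l \<cdot>\<^sub>m 1\<^sub>m k = (1 - l) \<cdot>\<^sub>m (1\<^sub>m k)"
    by (intro eq_matI) auto
  also have "det ((1 - l) \<cdot>\<^sub>m (1\<^sub>m k)) = (1 - l) ^ k" by simp
  finally show ?thesis .
qed

lemma one_minus_P_mult_vec:
  "x \<in> carrier_vec n \<Longrightarrow> (1\<^sub>m n - l \<cdot>\<^sub>m P) *\<^sub>v x = x - l \<cdot>\<^sub>v (P *\<^sub>v x)"
  using P by (simp add: minus_mult_distrib_mat_vec[of _ n n] smult_mat_mult_vec[of _ n n])

lemma scalar_prod_one_minus_P:
  assumes x: "x \<in> carrier_vec n"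
  shows "x \<bullet> ((1\<^sub>m n - l \<cdot>\<^sub>m P) *\<^sub>v x) = x \<bullet> x - l * ((P *\<^sub>v x) \<bullet> (P *\<^sub>v x))"
proof -
  have "(P *\<^sub>v x) \<bullet> (P *\<^sub>v x) = x \<bullet> (P *\<^sub>v x)"
    using P x P_self_adjoint[of x "P *\<^sub>v x"] P_P[OF x] by simp
  then show ?thesis
    using x P by (simp add: one_minus_P_mult_vec scalar_prod_minus_distrib[of _ n])
qed

text \<open>A projection does not increase the norm, so subtracting only a fraction of it keeps the
  form positive.\<close>

lemma spd_one_minus_P:
  assumes "0 \<le> l" "l < 1"
  shows "spd n (1\<^sub>m n - l \<cdot>\<^sub>m P)"
proof -
  have "x \<bullet> ((1\<^sub>m n - l \<cdot>\<^sub>m P) *\<^sub>v x) > 0" if x: "x \<in> carrier_vec n" "x \<noteq> 0\<^sub>v n" for x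
  proof -
    have "(x - P *\<^sub>v x) \<bullet> (x - P *\<^sub>v x) = x \<bullet> x - (P *\<^sub>v x) \<bullet> (P *\<^sub>v x)"
      using scalar_prod_self_minus[of x n "P *\<^sub>v x"] P x P_self_adjoint[of x "P *\<^sub>v x"] P_P[OF x(1)] by simp
    then have "(P *\<^sub>v x) \<bullet> (P *\<^sub>v x) \<le> x \<bullet> x" using scalar_prod_self_nonneg[of "x - P *\<^sub>v x"] by simp
    then have "l * ((P *\<^sub>v x) \<bullet> (P *\<^sub>v x)) \<le> l * (x \<bullet> x)" using assms by (intro mult_left_mono)
    moreover have "x \<bullet> x > 0" using spd_pos[OF spd_one x] x by simp
    then have "l * (x \<bullet> x) < x \<bullet> x" using assms by simp
    ultimately show ?thesis using scalar_prod_one_minus_P[OF x(1), of l] by simp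
  qed
  moreover have "transpose_mat (1\<^sub>m n - l \<cdot>\<^sub>m P) = 1\<^sub>m n - l \<cdot>\<^sub>m P"
    using P by (simp add: transpose_minus[of _ n n] transpose_mat_smult transpose_P)
  ultimately show ?thesis using P by (auto simp: spd_def)
qed

text \<open>A completion of the square in \<open>y\<close>: tempering moves the centre a fraction
  \<alpha> of the way from \<mu> to its projection, which gives \<nu>. As \<open>w\<close> is
  orthogonal to the column space, the shift leaves the projected part alone. The coefficient of
  \<open>w \<bullet> w\<close> is \<open>t - \<alpha> / 2\<close> on the left and
  \<open>- \<alpha>\<^sup>2 / 2\<close> on the right; the condition on \<open>t\<close> compares the
  two.\<close>

lemma exponent_le:
  assumes y: "y \<in> carrier_vec n" and \<mu>: "\<mu> \<in> carrier_vec n" and t: "2 * t \<le> \<alpha> * (1 - \<alpha>)"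
  defines "w \<equiv> \<mu> - P *\<^sub>v \<mu>" and "d \<equiv> y - \<mu>"
  defines "\<nu> \<equiv> \<mu> - \<alpha> \<cdot>\<^sub>v w"
  shows "t * (w \<bullet> w) + 2 * t * ((P *\<^sub>v d) \<bullet> (P *\<^sub>v d))
      - \<alpha> / 2 * ((y - P *\<^sub>v y) \<bullet> (y - P *\<^sub>v y) - d \<bullet> d) - d \<bullet> d / 2
    \<le> - ((y - \<nu>) \<bullet> ((1\<^sub>m n - (4 * t + \<alpha>) \<cdot>\<^sub>m P) *\<^sub>v (y - \<nu>))) / 2"
proof -
  have w: "w \<in> carrier_vec n" and d: "d \<in> carrier_vec n" and \<nu>: "\<nu> \<in> carrier_vec n"
    using P y \<mu> by (auto simp: w_def d_def \<nu>_def)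
  have Pw: "P *\<^sub>v w = 0\<^sub>v n"
    using P \<mu> by (simp add: w_def mult_minus_distrib_mat_vec[of _ n n] P_P)
  have Pd: "P *\<^sub>v d \<in> carrier_vec n" using P d by simp
  have wPd: "w \<bullet> (P *\<^sub>v d) = 0" using P_orthogonal[OF \<mu> d] by (simp add: w_def)
  have PdPd: "(P *\<^sub>v d) \<bullet> (P *\<^sub>v d) = d \<bullet> (P *\<^sub>v d)"
    using P d P_self_adjoint[of d "P *\<^sub>v d"] P_P[OF d] by simp
  have "P *\<^sub>v d = P *\<^sub>v y - P *\<^sub>v \<mu>" using P y \<mu> by (simp add: d_def mult_minus_distrib_mat_vec[of _ n n])
  then have "y - P *\<^sub>v y = (d - P *\<^sub>v d) + w"
    unfolding d_def w_def using y \<mu> P by auto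
  then have res: "(y - P *\<^sub>v y) \<bullet> (y - P *\<^sub>v y) =
      d \<bullet> d - (P *\<^sub>v d) \<bullet> (P *\<^sub>v d) + 2 * (d \<bullet> w) + w \<bullet> w"
    using scalar_prod_self_add[of "d - P *\<^sub>v d" n w] scalar_prod_self_minus[OF d Pd]
      PdPd wPd w d Pd comm_scalar_prod[OF Pd w] by (simp add: minus_scalar_prod_distrib[of _ n])
  have y\<nu>: "y - \<nu> = d + \<alpha> \<cdot>\<^sub>v w" unfolding d_def \<nu>_def using y \<mu> w by auto
  have "P *\<^sub>v (d + \<alpha> \<cdot>\<^sub>v w) = P *\<^sub>v d"
    using P d w Pw by (simp add: mult_add_distrib_mat_vec[of _ n n] mult_mat_vec[of _ n n])
      (auto intro!: eq_vecI)
  moreover have "(d + \<alpha> \<cdot>\<^sub>v w) \<bullet> (d + \<alpha> \<cdot>\<^sub>v w) = d \<bullet> d + 2 * \<alpha> * (d \<bullet> w) + \<alpha>\<^sup>2 * (w \<bullet> w)"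
    using scalar_prod_self_add[of d n "\<alpha> \<cdot>\<^sub>v w"] d w by (simp add: power2_eq_square)
  ultimately have quad: "(y - \<nu>) \<bullet> ((1\<^sub>m n - (4 * t + \<alpha>) \<cdot>\<^sub>m P) *\<^sub>v (y - \<nu>)) =
      d \<bullet> d + 2 * \<alpha> * (d \<bullet> w) + \<alpha>\<^sup>2 * (w \<bullet> w) - (4 * t + \<alpha>) * ((P *\<^sub>v d) \<bullet> (P *\<^sub>v d))"
    using scalar_prod_one_minus_P[of "y - \<nu>" "4 * t + \<alpha>"] d w y\<nu> by simp
  have "0 \<le> (\<alpha> * (1 - \<alpha>) - 2 * t) * (w \<bullet> w)"
    using t scalar_prod_self_nonneg by (intro mult_nonneg_nonneg) auto
  \<comment> \<open>\<open>W\<close>, \<open>E\<close> and \<open>D\<close> are the squared norms of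
    bias, projected noise and noise, and \<open>C\<close> is the product of noise and bias. The
    sides differ by half the premise.\<close>
  moreover have "t * W + 2 * t * E - \<alpha> / 2 * ((D - E + 2 * C + W) - D) - D / 2
      \<le> - (D + 2 * \<alpha> * C + \<alpha>\<^sup>2 * W - (4 * t + \<alpha>) * E) / 2"
    if "0 \<le> (\<alpha> * (1 - \<alpha>) - 2 * t) * W" for W E D C :: real
    using that by (simp add: field_simps power2_eq_square)
  ultimately show ?thesis unfolding res quad by blast
qed

end

subsection \<open>Prior and posterior as finite mixtures\<close>

lemma sub_cols_carrier:
  assumes "X \<in> carrier_mat n p" "S \<subseteq> {..<p}"
  shows "sub_cols X S \<in> carrier_mat n (card S)"
proof -
  have "{j. j < p \<and> j \<in> S} = S" using assms(2) by auto
  then have "card {j. j < p \<and> j \<in> S} = card S" by (rule arg_cong)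
  moreover have "dim_col X = p" "dim_row X = n" using assms(1) by auto
  ultimately show ?thesis unfolding sub_cols_def by (intro carrier_matI) (simp_all add: dim_submatrix)
qed

text \<open>The rank of an element within \<open>S\<close> is inverted by \<open>pick S\<close>,
  which gives injectivity; counting gives surjectivity.\<close>

lemma bij_betw_rank:
  fixes S :: "nat set"
  assumes "finite S"
  shows "bij_betw (\<lambda>j. card {i \<in> S. i < j}) S {..<card S}"
proof -
  have inj: "inj_on (\<lambda>j. card {i \<in> S. i < j}) S"
    by (rule inj_on_inverseI[of _ "pick S"]) (rule pick_card_in_set)
  have "(\<lambda>j. card {i \<in> S. i < j}) ` S \<subseteq> {..<card S}"
    using assms by (auto intro!: psubset_card_mono)
  then have "(\<lambda>j. card {i \<in> S. i < j}) ` S = {..<card S}"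
    using card_image[OF inj] by (intro card_subset_eq) auto
  with inj show ?thesis by (simp add: bij_betw_def)
qed

lemma mult_mat_vec_pad_zeros:
  assumes X: "X \<in> carrier_mat n p" and S: "S \<subseteq> {..<p}" and b: "b \<in> carrier_vec (card S)"
  shows "X *\<^sub>v pad_zeros p S b = sub_cols X S *\<^sub>v b"
proof (rule eq_vecI)
  note sc = sub_cols_carrier[OF X S]
  show "dim_vec (X *\<^sub>v pad_zeros p S b) = dim_vec (sub_cols X S *\<^sub>v b)" using X sc by simp
  fix i assume "i < dim_vec (sub_cols X S *\<^sub>v b)"
  then have i: "i < n" using sc by simp
  have fin: "finite S" using S finite_subset by blast
  let ?r = "\<lambda>j. card {a \<in> S. a < j}"
  have "(X *\<^sub>v pad_zeros p S b) $ i = (\<Sum>j<p. if j \<in> S then X $$ (i,j) * b $ ?r j else 0)"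
    using X i by (auto simp: scalar_prod_def atLeast0LessThan pad_zeros_def intro!: sum.cong)
  also have "\<dots> = (\<Sum>j\<in>S. X $$ (i,j) * b $ ?r j)"
    using S by (simp add: sum.If_cases Int_absorb1)
  also have "\<dots> = (\<Sum>j\<in>S. sub_cols X S $$ (i, ?r j) * b $ ?r j)"
  proof (intro sum.cong refl)
    fix j assume j: "j \<in> S"
    \<comment> \<open>\<open>submatrix\<close> addresses rows by their rank too, here within
      \<open>UNIV\<close>, where the rank of \<open>i\<close> is \<open>i\<close>.\<close>
    have "{a \<in> UNIV. a < i} = {..<i}" by auto
    then have "sub_cols X S $$ (i, ?r j) = X $$ (i,j)"
      using submatrix_index_card[of i X j UNIV S] X S i j by (auto simp: sub_cols_def)
    then show "X $$ (i,j) * b $ ?r j = sub_cols X S $$ (i, ?r j) * b $ ?r j" by simp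
  qed
  also have "\<dots> = (\<Sum>l<card S. sub_cols X S $$ (i, l) * b $ l)"
    by (rule sum.reindex_bij_betw[OF bij_betw_rank[OF fin]])
  also have "\<dots> = (sub_cols X S *\<^sub>v b) $ i"
    using sc i b by (auto simp: scalar_prod_def atLeast0LessThan intro!: sum.cong)
  finally show "(X *\<^sub>v pad_zeros p S b) $ i = (sub_cols X S *\<^sub>v b) $ i" .
qed

text \<open>Places the true coefficient vector in the range of the padding map of its own support,
  so that the least squares decomposition of that model applies to it.\<close>

lemma pad_zeros_supp:
  assumes "\<beta> \<in> carrier_vec p"
  shows "\<beta> = pad_zeros p (supp \<beta>) (vec (card (supp \<beta>)) (\<lambda>l. \<beta> $ pick (supp \<beta>) l))"
proof (rule eq_vecI)
  let ?S = "supp \<beta>"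
  fix j assume "j < dim_vec (pad_zeros p ?S (vec (card ?S) (\<lambda>l. \<beta> $ pick ?S l)))"
  then have j: "j < p" by (simp add: pad_zeros_def)
  show "\<beta> $ j = pad_zeros p ?S (vec (card ?S) (\<lambda>l. \<beta> $ pick ?S l)) $ j"
  proof (cases "j \<in> ?S")
    case True
    have "finite ?S" by (simp add: supp_def)
    then have "card {i \<in> ?S. i < j} < card ?S"
      using True by (intro psubset_card_mono) auto
    then show ?thesis using True j by (simp add: pad_zeros_def pick_card_in_set)
  next
    case False
    then show ?thesis using j assms by (auto simp: pad_zeros_def supp_def)
  qed
qed (use assms in \<open>simp add: pad_zeros_def\<close>)

text \<open>\<open>measure_of\<close> keeps the given set function only if it is a measure, here by
  exchanging a finite with a countable sum. The integral formula then follows by induction over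
  measurable functions; suprema pass through the finite sum because the integrals increase.\<close>

lemma
  fixes N :: "'i \<Rightarrow> 'a measure" and c :: "'i \<Rightarrow> ennreal"
  assumes I: "finite I" and N: "\<And>i. i \<in> I \<Longrightarrow> sets (N i) = sets M"
  defines "Q \<equiv> measure_of (space M) (sets M) (\<lambda>A. \<Sum>i\<in>I. c i * emeasure (N i) A)"
  shows emeasure_mixture: "A \<in> sets M \<Longrightarrow> emeasure Q A = (\<Sum>i\<in>I. c i * emeasure (N i) A)"
    and nn_integral_mixture: "f \<in> borel_measurable M \<Longrightarrow>
      (\<integral>\<^sup>+x. f x \<partial>Q) = (\<Sum>i\<in>I. c i * (\<integral>\<^sup>+x. f x \<partial>N i))"
proof -
  have setsQ: "sets Q = sets M" unfolding Q_def by simp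
  show em: "emeasure Q A = (\<Sum>i\<in>I. c i * emeasure (N i) A)" if "A \<in> sets M" for A
    unfolding Q_def
  proof (rule emeasure_measure_of_sigma)
    show "sigma_algebra (space M) (sets M)" ..
    show "positive (sets M) (\<lambda>A. \<Sum>i\<in>I. c i * emeasure (N i) A)" by (simp add: positive_def)
    show "countably_additive (sets M) (\<lambda>A. \<Sum>i\<in>I. c i * emeasure (N i) A)"
    proof (rule countably_additiveI)
      fix F :: "nat \<Rightarrow> 'a set"
      assume F: "range F \<subseteq> sets M" "disjoint_family F"
      have "(\<Sum>j. \<Sum>i\<in>I. c i * emeasure (N i) (F j)) = (\<Sum>i\<in>I. \<Sum>j. c i * emeasure (N i) (F j))"
        by (rule suminf_sum) simp
      also have "\<dots> = (\<Sum>i\<in>I. c i * emeasure (N i) (\<Union>j. F j))"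
        using F N by (intro sum.cong refl) (simp add: suminf_emeasure)
      finally show "(\<Sum>j. \<Sum>i\<in>I. c i * emeasure (N i) (F j)) = (\<Sum>i\<in>I. c i * emeasure (N i) (\<Union>j. F j))" .
    qed
  qed (use that in simp)
  have meas: "(borel_measurable Q :: ('a \<Rightarrow> ennreal) set) = borel_measurable M"
    by (intro measurable_cong_sets setsQ refl)
  have measN: "(borel_measurable (N i) :: ('a \<Rightarrow> ennreal) set) = borel_measurable M" if "i \<in> I" for i
    by (intro measurable_cong_sets N[OF that] refl)
  assume "f \<in> borel_measurable M"
  then show "(\<integral>\<^sup>+x. f x \<partial>Q) = (\<Sum>i\<in>I. c i * (\<integral>\<^sup>+x. f x \<partial>N i))"
  proof (induction rule: borel_measurable_induct)
    case (cong f g)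
    have "space (N i) = space M" if "i \<in> I" for i using N[OF that] by (rule sets_eq_imp_space_eq)
    moreover have "space Q = space M" using setsQ by (rule sets_eq_imp_space_eq)
    ultimately show ?case using cong(3,4) by (simp cong: nn_integral_cong_simp)
  next
    case (set A)
    then show ?case using em setsQ N by simp
  next
    case (mult u v)
    then have "(\<integral>\<^sup>+x. v * u x \<partial>N i) = v * (\<integral>\<^sup>+x. u x \<partial>N i)" if "i \<in> I" for i
      using measN[OF that] by (intro nn_integral_cmult) simp
    then show ?case using mult meas by (simp add: nn_integral_cmult sum_distrib_left ac_simps)
  next
    case (add u v)
    then have "(\<integral>\<^sup>+x. v x + u x \<partial>N i) = (\<integral>\<^sup>+x. v x \<partial>N i) + (\<integral>\<^sup>+x. u x \<partial>N i)" if "i \<in> I" for i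
      using measN[OF that] by (intro nn_integral_add) simp_all
    then show ?case using add meas by (simp add: nn_integral_add sum.distrib distrib_left)
  next
    case (seq U)
    have mono: "incseq (\<lambda>j. c i * (\<integral>\<^sup>+x. U j x \<partial>N i))" for i
      using seq(3) by (intro incseq_SucI mult_left_mono nn_integral_mono) (auto simp: incseq_Suc_iff le_fun_def)
    have "(\<integral>\<^sup>+x. (SUP j. U j) x \<partial>Q) = (SUP j. \<integral>\<^sup>+x. U j x \<partial>Q)"
      using seq meas by (simp add: nn_integral_monotone_convergence_SUP image_comp)
    also have "\<dots> = (SUP j. \<Sum>i\<in>I. c i * (\<integral>\<^sup>+x. U j x \<partial>N i))"
      using seq by simp
    also have "\<dots> = (\<Sum>i\<in>I. SUP j. c i * (\<integral>\<^sup>+x. U j x \<partial>N i))"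
      using mono by (intro ennreal_SUP_sum) auto
    also have "\<dots> = (\<Sum>i\<in>I. c i * (\<integral>\<^sup>+x. (SUP j. U j) x \<partial>N i))"
      using seq measN by (intro sum.cong refl)
        (simp add: nn_integral_monotone_convergence_SUP SUP_mult_left_ennreal image_comp)
    finally show ?case .
  qed
qed

section \<open>Prior and unnormalised posterior as sums over models\<close>

lemma sets_mvn [simp]: "sets (mvn \<mu> \<Sigma>) = sets (lborel_vec (dim_vec \<mu>))"
  by (simp add: mvn_def)

lemma sets_model_component [simp]: "sets (model_component \<sigma> \<gamma> X y S) = sets (lborel_vec (dim_col X))"
  by (simp add: model_component_def)

lemma sets_emp_prior [simp]: "sets (emp_prior \<sigma> \<gamma> a c X y) = sets (lborel_vec (dim_col X))"
  by (simp add: emp_prior_def del: space_lborel_vec)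

lemma nn_integral_emp_prior:
  "f \<in> borel_measurable (lborel_vec (dim_col X)) \<Longrightarrow>
    (\<integral>\<^sup>+\<beta>. f \<beta> \<partial>emp_prior \<sigma> \<gamma> a c X y) =
    (\<Sum>S\<in>Pow {..<dim_col X}. ennreal (model_prior a c X S) * (\<integral>\<^sup>+\<beta>. f \<beta> \<partial>model_component \<sigma> \<gamma> X y S))"
  unfolding emp_prior_def by (rule nn_integral_mixture) auto

lemma mat_inv_smult_one:
  assumes "(r :: real) \<noteq> 0"
  shows "mat_inv (r \<cdot>\<^sub>m 1\<^sub>m n) = (1 / r) \<cdot>\<^sub>m 1\<^sub>m n"
  using assms by (intro mat_inv_unique[of _ n])
    (auto simp: mult_smult_assoc_mat[of _ n n _ n] mult_smult_distrib[of _ n n _ n])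

lemma mvn_density_smult_one:
  assumes "\<sigma> > 0" "\<mu> \<in> carrier_vec n" "y \<in> carrier_vec n"
  shows "mvn_density \<mu> (\<sigma>\<^sup>2 \<cdot>\<^sub>m 1\<^sub>m n) y =
    exp (- ((y - \<mu>) \<bullet> (y - \<mu>)) / (2 * \<sigma>\<^sup>2)) / sqrt ((2 * pi * \<sigma>\<^sup>2) ^ n)"
  using assms
  by (simp add: mvn_density_def mat_inv_smult_one smult_mat_mult_vec[of _ n n] power_mult_distrib field_simps)

lemma response_density_eq:
  assumes "\<sigma> > 0" "X \<in> carrier_mat n p" "\<beta> \<in> carrier_vec p" "y \<in> carrier_vec n"
  shows "response_density X \<sigma> \<beta> y =
    exp (- ((y - X *\<^sub>v \<beta>) \<bullet> (y - X *\<^sub>v \<beta>)) / (2 * \<sigma>\<^sup>2)) / sqrt ((2 * pi * \<sigma>\<^sup>2) ^ n)"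
  using assms by (simp add: response_density_def mvn_density_smult_one)

lemma measurable_response_density:
  assumes "\<sigma> > 0" "X \<in> carrier_mat n p" "y \<in> carrier_vec n"
  shows "(\<lambda>\<beta>. response_density X \<sigma> \<beta> y) \<in> borel_measurable (lborel_vec p)"
proof -
  have "(\<lambda>\<beta>. (y - X *\<^sub>v \<beta>) \<bullet> (y - X *\<^sub>v \<beta>)) \<in> borel_measurable (lborel_vec p)"
    using assms by (intro measurable_scalar_prod[of _ _ n] measurable_minus_vec measurable_const_vec
        measurable_mult_mat_vec[of _ n p]) auto
  then have "(\<lambda>\<beta>. exp (- ((y - X *\<^sub>v \<beta>) \<bullet> (y - X *\<^sub>v \<beta>)) / (2 * \<sigma>\<^sup>2)) / sqrt ((2 * pi * \<sigma>\<^sup>2) ^ n))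
      \<in> borel_measurable (lborel_vec p)"
    by simp
  then show ?thesis
    by (rule measurable_cong[THEN iffD1, rotated]) (use response_density_eq[OF assms(1,2) _ assms(3)] in simp)
qed

lemma emeasure_unnorm_posterior:
  assumes "\<sigma> > 0" "X \<in> carrier_mat n p" "y \<in> carrier_vec n" "A \<in> sets (lborel_vec p)"
  shows "emeasure (unnorm_posterior \<sigma> \<alpha> \<gamma> a c X y) A =
    (\<Sum>S\<in>Pow {..<p}. ennreal (model_prior a c X S) *
       (\<integral>\<^sup>+\<beta>. ennreal (response_density X \<sigma> \<beta> y powr \<alpha>) * indicator A \<beta> \<partial>model_component \<sigma> \<gamma> X y S))"
proof -
  have p: "dim_col X = p" using assms by simp
  have m: "(\<lambda>\<beta>. ennreal (response_density X \<sigma> \<beta> y powr \<alpha>)) \<in> borel_measurable (lborel_vec p)"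
    using measurable_response_density[OF assms(1-3)] by simp
  moreover have "borel_measurable (emp_prior \<sigma> \<gamma> a c X y) = borel_measurable (lborel_vec p)"
    using sets_emp_prior[of \<sigma> \<gamma> a c X y] p by (intro measurable_cong_sets) auto
  ultimately have "emeasure (unnorm_posterior \<sigma> \<alpha> \<gamma> a c X y) A =
    (\<integral>\<^sup>+\<beta>. ennreal (response_density X \<sigma> \<beta> y powr \<alpha>) * indicator A \<beta> \<partial>emp_prior \<sigma> \<gamma> a c X y)"
    using assms p unfolding unnorm_posterior_def by (subst emeasure_density) auto
  also have "\<dots> = (\<Sum>S\<in>Pow {..<p}. ennreal (model_prior a c X S) *
       (\<integral>\<^sup>+\<beta>. ennreal (response_density X \<sigma> \<beta> y powr \<alpha>) * indicator A \<beta> \<partial>model_component \<sigma> \<gamma> X y S))"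
    using m assms(4) p by (subst nn_integral_emp_prior) auto
  finally show ?thesis .
qed

text \<open>If the normalising constant is 0 or infinite, its product with its own inverse is 0 in
  \<open>ennreal\<close>; otherwise it is 1.\<close>

lemma emeasure_posterior_le_1: "emeasure (posterior \<sigma> \<alpha> \<gamma> a c X y) A \<le> 1"
proof -
  let ?U = "unnorm_posterior \<sigma> \<alpha> \<gamma> a c X y"
  have "inverse (emeasure ?U (space ?U)) * emeasure ?U A \<le> inverse (emeasure ?U (space ?U)) * emeasure ?U (space ?U)"
    by (intro mult_left_mono emeasure_space) simp
  also have "\<dots> \<le> 1"
    using ennreal_divide_self[of "emeasure ?U (space ?U)"]
    by (cases "emeasure ?U (space ?U) = 0"; cases "emeasure ?U (space ?U) = \<infinity>")
       (auto simp: divide_ennreal_def mult.commute less_top)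
  finally show ?thesis unfolding posterior_def Let_def by simp
qed

subsection \<open>A single model\<close>

locale submodel =
  fixes X :: "real mat" and S :: "nat set" and n p :: nat
  assumes X: "X \<in> carrier_mat n p" and S: "S \<subseteq> {..<p}"
    and inv: "invertible_mat (gram X S)"

sublocale submodel \<subseteq> full_rank_design "sub_cols X S" n "card S"
  using sub_cols_carrier[OF X S] inv by unfold_locales (simp_all add: gram_def)

context submodel
begin

lemma gram_eq: "gram X S = G"
  by (simp add: gram_def G_def)

lemma lse_eq: "lse X y S = coef y"
  by (simp add: lse_def coef_def H_def gram_eq)

lemma measurable_pad_zeros_mvn:
  "\<mu> \<in> carrier_vec (card S) \<Longrightarrow> pad_zeros p S \<in> measurable (mvn \<mu> \<Sigma>) (lborel_vec p)"
  using measurable_pad_zeros[OF S] measurable_cong_sets[of "mvn \<mu> \<Sigma>" "lborel_vec (card S)" "lborel_vec p" "lborel_vec p"]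
  by simp

lemma nn_integral_model_component:
  assumes "y \<in> carrier_vec n" "f \<in> borel_measurable (lborel_vec p)"
  shows "(\<integral>\<^sup>+\<beta>. f \<beta> \<partial>model_component \<sigma> \<gamma> X y S) =
    (\<integral>\<^sup>+b. f (pad_zeros p S b) \<partial>mvn (coef y) ((\<sigma>\<^sup>2 / \<gamma>) \<cdot>\<^sub>m H))"
  using measurable_pad_zeros_mvn[OF coef[OF assms(1)]] assms X
  by (simp add: model_component_def lse_eq gram_eq H_def nn_integral_distr)

lemma space_mvn_coef: "y \<in> carrier_vec n \<Longrightarrow> space (mvn (coef y) \<Sigma>) = carrier_vec (card S)"
  using coef[of y] by (simp add: mvn_def)

lemma mult_pad_zeros: "b \<in> carrier_vec (card S) \<Longrightarrow> X *\<^sub>v pad_zeros p S b = sub_cols X S *\<^sub>v b"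
  by (rule mult_mat_vec_pad_zeros[OF X S])

lemma pad_zeros_carrier: "pad_zeros p S b \<in> carrier_vec p"
  by (simp add: pad_zeros_def)

lemma measurable_quadratic_coef:
  assumes "y \<in> carrier_vec n"
  shows "(\<lambda>b. (b - coef y) \<bullet> (G *\<^sub>v (b - coef y))) \<in> borel_measurable (mvn (coef y) \<Sigma>)"
proof -
  have "(\<lambda>b. (b - coef y) \<bullet> (G *\<^sub>v (b - coef y))) \<in> borel_measurable (lborel_vec (card S))"
    using coef[OF assms] G
    by (intro measurable_scalar_prod[of _ _ "card S"] measurable_minus_vec measurable_const_vec
        measurable_mult_mat_vec[of _ _ "card S"]) auto
  then show ?thesis using coef[OF assms] by (simp add: mvn_def)
qed

text \<open>The component has precision
  \<open>(\<gamma> / \<sigma>\<^sup>2) \<cdot>\<^sub>m G\<close>, relative to which the exponent has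
  weight \<open>\<delta> / \<gamma>\<close>. The lower bound for the evidence takes \<alpha> for
  \<delta>, the upper bound for the numerator takes \<open>\<alpha> - 4 * t\<close>.\<close>

lemma nn_integral_exp_quadratic_coef:
  assumes y: "y \<in> carrier_vec n" and "\<sigma> > 0" "\<gamma> > 0" "\<delta> \<ge> 0"
  shows "(\<integral>\<^sup>+b. ennreal (exp (- \<delta> * ((b - coef y) \<bullet> (G *\<^sub>v (b - coef y))) / (2 * \<sigma>\<^sup>2)))
      \<partial>mvn (coef y) ((\<sigma>\<^sup>2 / \<gamma>) \<cdot>\<^sub>m H)) = ennreal (sqrt (1 / (1 + \<delta> / \<gamma>) ^ card S))"
proof -
  let ?r = "\<sigma>\<^sup>2 / \<gamma>" and ?A = "(\<gamma> / \<sigma>\<^sup>2) \<cdot>\<^sub>m G"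
  have A: "spd (card S) ?A" using assms by (intro spd_smult spd_G) simp
  have inv1: "(?r \<cdot>\<^sub>m H) * ?A = 1\<^sub>m (card S)"
    using H G HG assms
    by (simp add: mult_smult_assoc_mat[of _ "card S" "card S" _ "card S"] mult_smult_distrib[of _ "card S" "card S" _ "card S"])
       (auto intro!: eq_matI)
  have inv2: "?A * (?r \<cdot>\<^sub>m H) = 1\<^sub>m (card S)"
    using H G GH assms
    by (simp add: mult_smult_assoc_mat[of _ "card S" "card S" _ "card S"] mult_smult_distrib[of _ "card S" "card S" _ "card S"])
       (auto intro!: eq_matI)
  have "(\<integral>\<^sup>+b. ennreal (exp (- (\<delta> / \<gamma>) * ((b - coef y) \<bullet> (?A *\<^sub>v (b - coef y))) / 2)) \<partial>mvn (coef y) (?r \<cdot>\<^sub>m H))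
    = ennreal (sqrt (1 / (1 + \<delta> / \<gamma>) ^ card S))"
    using assms coef[OF y] H G A inv1 inv2
    by (intro nn_integral_mvn_exp_mahalanobis) auto
  moreover have "(\<integral>\<^sup>+b. ennreal (exp (- \<delta> * ((b - coef y) \<bullet> (G *\<^sub>v (b - coef y))) / (2 * \<sigma>\<^sup>2)))
      \<partial>mvn (coef y) (?r \<cdot>\<^sub>m H)) =
    (\<integral>\<^sup>+b. ennreal (exp (- (\<delta> / \<gamma>) * ((b - coef y) \<bullet> (?A *\<^sub>v (b - coef y))) / 2)) \<partial>mvn (coef y) (?r \<cdot>\<^sub>m H))"
  proof (rule nn_integral_cong)
    fix b assume "b \<in> space (mvn (coef y) (?r \<cdot>\<^sub>m H))"
    then have "b - coef y \<in> carrier_vec (card S)" using space_mvn_coef[OF y] coef[OF y] by simp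
    then have "(b - coef y) \<bullet> (?A *\<^sub>v (b - coef y)) = \<gamma> / \<sigma>\<^sup>2 * ((b - coef y) \<bullet> (G *\<^sub>v (b - coef y)))"
      using G by (simp add: smult_mat_mult_vec[of _ "card S" "card S"])
    then show "ennreal (exp (- \<delta> * ((b - coef y) \<bullet> (G *\<^sub>v (b - coef y))) / (2 * \<sigma>\<^sup>2))) =
       ennreal (exp (- (\<delta> / \<gamma>) * ((b - coef y) \<bullet> (?A *\<^sub>v (b - coef y))) / 2))"
      using assms by (simp add: field_simps)
  qed
  ultimately show ?thesis by simp
qed

lemma response_density_pad_zeros:
  assumes "y \<in> carrier_vec n" "b \<in> carrier_vec (card S)" "\<sigma> > 0"
  shows "response_density X \<sigma> (pad_zeros p S b) y powr \<alpha> =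
    (1 / sqrt ((2 * pi * \<sigma>\<^sup>2) ^ n)) powr \<alpha> *
    exp (- \<alpha> * ((y - P *\<^sub>v y) \<bullet> (y - P *\<^sub>v y)) / (2 * \<sigma>\<^sup>2)) *
    exp (- \<alpha> * ((b - coef y) \<bullet> (G *\<^sub>v (b - coef y))) / (2 * \<sigma>\<^sup>2))"
proof -
  have "response_density X \<sigma> (pad_zeros p S b) y powr \<alpha> =
    (1 / sqrt ((2 * pi * \<sigma>\<^sup>2) ^ n)) powr \<alpha> *
    (exp (- ((y - P *\<^sub>v y) \<bullet> (y - P *\<^sub>v y) + (b - coef y) \<bullet> (G *\<^sub>v (b - coef y))) / (2 * \<sigma>\<^sup>2))) powr \<alpha>"
    using assms
    by (simp add: response_density_eq[OF _ X] pad_zeros_carrier mult_pad_zeros residual_decomp powr_divide)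
  also have "\<dots> = (1 / sqrt ((2 * pi * \<sigma>\<^sup>2) ^ n)) powr \<alpha> *
    exp (- \<alpha> * ((y - P *\<^sub>v y) \<bullet> (y - P *\<^sub>v y)) / (2 * \<sigma>\<^sup>2) - \<alpha> * ((b - coef y) \<bullet> (G *\<^sub>v (b - coef y))) / (2 * \<sigma>\<^sup>2))"
    by (simp add: powr_def algebra_simps add_divide_distrib diff_divide_distrib)
  finally show ?thesis by (simp add: exp_diff exp_minus field_simps)
qed

text \<open>In the true model the least squares fit is at least as likely as \<beta>', and the
  spread of the prior component around the fit costs the square root. The bound holds for every
  \<open>y\<close>, so no exceptional event has to be split off.\<close>

lemma evidence_ge:
  assumes "\<sigma> > 0" "\<gamma> > 0" "\<alpha> \<ge> 0" and y: "y \<in> carrier_vec n"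
    and \<beta>: "\<beta>' \<in> carrier_vec p" "supp \<beta>' = S"
  shows "ennreal (response_density X \<sigma> \<beta>' y powr \<alpha> * sqrt (1 / (1 + \<alpha> / \<gamma>) ^ card S))
    \<le> (\<integral>\<^sup>+\<beta>. ennreal (response_density X \<sigma> \<beta> y powr \<alpha>) \<partial>model_component \<sigma> \<gamma> X y S)"
proof -
  let ?K = "(1 / sqrt ((2 * pi * \<sigma>\<^sup>2) ^ n)) powr \<alpha>"
  let ?r = "exp (- \<alpha> * ((y - P *\<^sub>v y) \<bullet> (y - P *\<^sub>v y)) / (2 * \<sigma>\<^sup>2))"
  obtain b where b: "b \<in> carrier_vec (card S)" "\<beta>' = pad_zeros p S b"
    using that[OF vec_carrier] pad_zeros_supp[OF \<beta>(1)] \<beta>(2) by simp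
  have "(b - coef y) \<bullet> (G *\<^sub>v (b - coef y)) \<ge> 0"
    using scalar_prod_G[of "b - coef y"] b coef[OF y] scalar_prod_self_nonneg by simp
  then have "exp (- \<alpha> * ((b - coef y) \<bullet> (G *\<^sub>v (b - coef y))) / (2 * \<sigma>\<^sup>2)) \<le> 1"
    using assms(3) by simp
  then have "response_density X \<sigma> \<beta>' y powr \<alpha> \<le> ?K * ?r"
    unfolding b(2) response_density_pad_zeros[OF y b(1) assms(1)]
    by (intro mult_right_le_one_le) auto
  then have "ennreal (response_density X \<sigma> \<beta>' y powr \<alpha> * sqrt (1 / (1 + \<alpha> / \<gamma>) ^ card S))
    \<le> ennreal (?K * ?r * sqrt (1 / (1 + \<alpha> / \<gamma>) ^ card S))"
    using assms by (intro ennreal_leI mult_right_mono) auto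
  also have "\<dots> = ennreal (?K * ?r) *
     (\<integral>\<^sup>+b. ennreal (exp (- \<alpha> * ((b - coef y) \<bullet> (G *\<^sub>v (b - coef y))) / (2 * \<sigma>\<^sup>2)))
      \<partial>mvn (coef y) ((\<sigma>\<^sup>2 / \<gamma>) \<cdot>\<^sub>m H))"
    using assms(2,3) by (subst nn_integral_exp_quadratic_coef[OF y assms(1-3)]) (rule ennreal_mult'', simp)
  also have "\<dots> = (\<integral>\<^sup>+b. ennreal (?K * ?r) * ennreal (exp (- \<alpha> * ((b - coef y) \<bullet> (G *\<^sub>v (b - coef y))) / (2 * \<sigma>\<^sup>2)))
      \<partial>mvn (coef y) ((\<sigma>\<^sup>2 / \<gamma>) \<cdot>\<^sub>m H))"
    using measurable_quadratic_coef[OF y] by (intro nn_integral_cmult[symmetric]) simp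
  also have "\<dots> = (\<integral>\<^sup>+b. ennreal (response_density X \<sigma> (pad_zeros p S b) y powr \<alpha>)
      \<partial>mvn (coef y) ((\<sigma>\<^sup>2 / \<gamma>) \<cdot>\<^sub>m H))"
    using assms(1) space_mvn_coef[OF y]
    by (intro nn_integral_cong) (simp add: response_density_pad_zeros[OF y] ennreal_mult''[symmetric])
  also have "\<dots> = (\<integral>\<^sup>+\<beta>. ennreal (response_density X \<sigma> \<beta> y powr \<alpha>) \<partial>model_component \<sigma> \<gamma> X y S)"
    using measurable_response_density[OF assms(1) X y]
    by (subst nn_integral_model_component[OF y]) auto
  finally show ?thesis .
qed

text \<open>
  Bounds the logarithm of the prior average, over the event where the prediction error exceeds a
  given threshold, of the tempered likelihood ratio, up to the term from the threshold.
\<close>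

definition log_ratio :: "real \<Rightarrow> real \<Rightarrow> real \<Rightarrow> real vec \<Rightarrow> real vec \<Rightarrow> real" where
  "log_ratio \<sigma> \<alpha> t \<mu> y =
     (t * ((\<mu> - P *\<^sub>v \<mu>) \<bullet> (\<mu> - P *\<^sub>v \<mu>)) + 2 * t * ((P *\<^sub>v (y - \<mu>)) \<bullet> (P *\<^sub>v (y - \<mu>)))
      - \<alpha> / 2 * ((y - P *\<^sub>v y) \<bullet> (y - P *\<^sub>v y) - (y - \<mu>) \<bullet> (y - \<mu>))) / \<sigma>\<^sup>2"

text \<open>A Chernoff bound within one model: on \<open>A\<close> the surplus of the prediction
  error over \<tau> is nonnegative and may be added to the exponent. The share of the coefficient
  deviation lowers its weight in the likelihood from \<alpha> to \<open>\<alpha> - 4 * t\<close>;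
  the rest is free of \<beta> and forms \<open>log_ratio\<close>.\<close>

lemma nn_integral_component_le:
  assumes "\<sigma> > 0" "\<gamma> > 0" and t: "0 \<le> t" "4 * t \<le> \<alpha>" and y: "y \<in> carrier_vec n"
    and \<beta>: "\<beta>' \<in> carrier_vec p" and A: "A \<in> sets (lborel_vec p)"
    and \<tau>: "\<And>\<beta>. \<beta> \<in> A \<Longrightarrow> \<tau> \<le> t * ((X *\<^sub>v \<beta> - X *\<^sub>v \<beta>') \<bullet> (X *\<^sub>v \<beta> - X *\<^sub>v \<beta>')) / \<sigma>\<^sup>2"
  shows "(\<integral>\<^sup>+\<beta>. ennreal (response_density X \<sigma> \<beta> y powr \<alpha>) * indicator A \<beta> \<partial>model_component \<sigma> \<gamma> X y S)
    \<le> ennreal (response_density X \<sigma> \<beta>' y powr \<alpha> * exp (- \<tau>) * exp (log_ratio \<sigma> \<alpha> t (X *\<^sub>v \<beta>') y))"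
proof -
  let ?K = "(1 / sqrt ((2 * pi * \<sigma>\<^sup>2) ^ n)) powr \<alpha>"
  let ?\<mu> = "X *\<^sub>v \<beta>'"
  let ?\<Sigma> = "(\<sigma>\<^sup>2 / \<gamma>) \<cdot>\<^sub>m H"
  have \<mu>: "?\<mu> \<in> carrier_vec n" using X \<beta> by simp
  let ?B = "response_density X \<sigma> \<beta>' y powr \<alpha> * exp (- \<tau>) * exp (log_ratio \<sigma> \<alpha> t ?\<mu> y)"
  \<comment> \<open>\<open>R\<close>, \<open>D\<close>, \<open>W\<close> and \<open>E\<close> are
    the squared norms of residual, noise, bias and projected noise, and \<open>q\<close> is the
    quadratic form of the coefficient deviation. The sides differ by the slack in the
    premise.\<close>
  have sq: "- \<alpha> * R / (2 * \<sigma>\<^sup>2) + - \<alpha> * q / (2 * \<sigma>\<^sup>2) \<le> - \<alpha> * D / (2 * \<sigma>\<^sup>2) + - \<tau>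
      + (t * W + 2 * t * E - \<alpha> / 2 * (R - D)) / \<sigma>\<^sup>2 + - (\<alpha> - 4 * t) * q / (2 * \<sigma>\<^sup>2)"
    if "\<tau> \<le> t * (W + 2 * q + 2 * E) / \<sigma>\<^sup>2" for R q D W E :: real
  proof -
    have "- \<alpha> * D / (2 * \<sigma>\<^sup>2) + - \<tau> + (t * W + 2 * t * E - \<alpha> / 2 * (R - D)) / \<sigma>\<^sup>2 + - (\<alpha> - 4 * t) * q / (2 * \<sigma>\<^sup>2)
      = - \<alpha> * R / (2 * \<sigma>\<^sup>2) + - \<alpha> * q / (2 * \<sigma>\<^sup>2) + (t * (W + 2 * q + 2 * E) / \<sigma>\<^sup>2 - \<tau>)"
      by (simp add: add_divide_distrib diff_divide_distrib algebra_simps)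
    then show ?thesis using that by linarith
  qed
  have B: "?B = ?K * exp (- \<alpha> * ((y - ?\<mu>) \<bullet> (y - ?\<mu>)) / (2 * \<sigma>\<^sup>2)) * exp (- \<tau>) * exp (log_ratio \<sigma> \<alpha> t ?\<mu> y)"
    using assms(1) by (simp add: response_density_eq[OF _ X \<beta> y] powr_divide) (simp add: powr_def field_simps)
  have "(\<integral>\<^sup>+\<beta>. ennreal (response_density X \<sigma> \<beta> y powr \<alpha>) * indicator A \<beta> \<partial>model_component \<sigma> \<gamma> X y S)
    = (\<integral>\<^sup>+b. ennreal (response_density X \<sigma> (pad_zeros p S b) y powr \<alpha>) * indicator A (pad_zeros p S b)
        \<partial>mvn (coef y) ?\<Sigma>)"
    using measurable_response_density[OF assms(1) X y] A
    by (intro nn_integral_model_component[OF y] borel_measurable_times_ennreal) auto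
  also have "\<dots> \<le> (\<integral>\<^sup>+b. ennreal ?B * ennreal (exp (- (\<alpha> - 4 * t) * ((b - coef y) \<bullet> (G *\<^sub>v (b - coef y))) / (2 * \<sigma>\<^sup>2)))
      \<partial>mvn (coef y) ?\<Sigma>)"
  proof (rule nn_integral_mono)
    fix b assume "b \<in> space (mvn (coef y) ?\<Sigma>)"
    then have b: "b \<in> carrier_vec (card S)" using space_mvn_coef[OF y] by simp
    let ?q = "(b - coef y) \<bullet> (G *\<^sub>v (b - coef y))"
    show "ennreal (response_density X \<sigma> (pad_zeros p S b) y powr \<alpha>) * indicator A (pad_zeros p S b)
      \<le> ennreal ?B * ennreal (exp (- (\<alpha> - 4 * t) * ?q / (2 * \<sigma>\<^sup>2)))"
    proof (cases "pad_zeros p S b \<in> A")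
      case True
      have "\<tau> \<le> t * ((X *\<^sub>v pad_zeros p S b - ?\<mu>) \<bullet> (X *\<^sub>v pad_zeros p S b - ?\<mu>)) / \<sigma>\<^sup>2"
        by (rule \<tau>[OF True])
      also have "\<dots> \<le> t * ((?\<mu> - P *\<^sub>v ?\<mu>) \<bullet> (?\<mu> - P *\<^sub>v ?\<mu>) + 2 * ?q
          + 2 * ((P *\<^sub>v (y - ?\<mu>)) \<bullet> (P *\<^sub>v (y - ?\<mu>)))) / \<sigma>\<^sup>2"
        unfolding mult_pad_zeros[OF b] using t(1) prediction_error_le[OF y \<mu> b]
        by (intro divide_right_mono mult_left_mono) auto
      finally have le: "- \<alpha> * ((y - P *\<^sub>v y) \<bullet> (y - P *\<^sub>v y)) / (2 * \<sigma>\<^sup>2) + - \<alpha> * ?q / (2 * \<sigma>\<^sup>2)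
        \<le> - \<alpha> * ((y - ?\<mu>) \<bullet> (y - ?\<mu>)) / (2 * \<sigma>\<^sup>2) + - \<tau> + log_ratio \<sigma> \<alpha> t ?\<mu> y + - (\<alpha> - 4 * t) * ?q / (2 * \<sigma>\<^sup>2)"
        unfolding log_ratio_def by (rule sq)
      have "response_density X \<sigma> (pad_zeros p S b) y powr \<alpha> \<le> ?B * exp (- (\<alpha> - 4 * t) * ?q / (2 * \<sigma>\<^sup>2))"
        unfolding B
        unfolding response_density_pad_zeros[OF y b assms(1)] mult.assoc exp_add[symmetric]
        using le by (intro mult_left_mono) (auto simp: add.assoc)
      then show ?thesis using True by (simp add: ennreal_mult'[symmetric] ennreal_leI)
    qed simp
  qed
  also have "\<dots> = ennreal ?B * ennreal (sqrt (1 / (1 + (\<alpha> - 4 * t) / \<gamma>) ^ card S))"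
    using measurable_quadratic_coef[OF y] t nn_integral_exp_quadratic_coef[OF y assms(1,2), of "\<alpha> - 4 * t"]
    by (subst nn_integral_cmult) auto
  \<comment> \<open>The remaining Gaussian factor is at most 1 by
    \<open>4 * t \<le> \<alpha>\<close> and is dropped.\<close>
  also have "\<dots> \<le> ennreal ?B * ennreal 1"
  proof (intro mult_left_mono ennreal_leI)
    have "1 \<le> (1 + (\<alpha> - 4 * t) / \<gamma>) ^ card S" using assms by (intro one_le_power) simp
    then show "sqrt (1 / (1 + (\<alpha> - 4 * t) / \<gamma>) ^ card S) \<le> 1" by simp
  qed simp
  finally show ?thesis by simp
qed

lemma measurable_log_ratio:
  assumes \<mu>: "\<mu> \<in> carrier_vec n"
  shows "log_ratio \<sigma> \<alpha> t \<mu> \<in> borel_measurable (lborel_vec n)"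
proof -
  have "(\<lambda>y. (P *\<^sub>v (y - \<mu>)) \<bullet> (P *\<^sub>v (y - \<mu>))) \<in> borel_measurable (lborel_vec n)"
    "(\<lambda>y. (y - P *\<^sub>v y) \<bullet> (y - P *\<^sub>v y)) \<in> borel_measurable (lborel_vec n)"
    "(\<lambda>y. (y - \<mu>) \<bullet> (y - \<mu>)) \<in> borel_measurable (lborel_vec n)"
    using \<mu> P by (intro measurable_scalar_prod[of _ _ n] measurable_minus_vec measurable_const_vec
        measurable_mult_mat_vec[of P n n]; simp)+
  then show ?thesis unfolding log_ratio_def[abs_def] by simp
qed

text \<open>By \<open>exponent_le\<close>, sampling density times integrand is at most an
  unnormalised Gaussian centred at \<open>?\<nu>\<close>. The normalising factors of dimension
  \<open>n\<close> cancel and only the determinant of the deformed precision survives. The bound no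
  longer contains \<mu>, hence is uniform over the truth.\<close>

lemma nn_integral_exp_log_ratio_le:
  assumes "\<sigma> > 0" and t: "0 \<le> t" "0 \<le> \<alpha>" "2 * t \<le> \<alpha> * (1 - \<alpha>)" "4 * t + \<alpha> < 1"
    and \<mu>: "\<mu> \<in> carrier_vec n"
  shows "(\<integral>\<^sup>+y. ennreal (exp (log_ratio \<sigma> \<alpha> t \<mu> y)) \<partial>mvn \<mu> (\<sigma>\<^sup>2 \<cdot>\<^sub>m 1\<^sub>m n))
    \<le> ennreal (sqrt (1 / (1 - (4 * t + \<alpha>)) ^ card S))"
proof -
  let ?l = "4 * t + \<alpha>"
  let ?\<nu> = "\<mu> - \<alpha> \<cdot>\<^sub>v (\<mu> - P *\<^sub>v \<mu>)"
  let ?A = "1\<^sub>m n - ?l \<cdot>\<^sub>m P"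
  let ?c = "sqrt ((2 * pi * \<sigma>\<^sup>2) ^ n)"
  have \<nu>: "?\<nu> \<in> carrier_vec n" using \<mu> P by simp
  have Ac: "?A \<in> carrier_mat n n" using P by (intro minus_carrier_mat) auto
  have A: "spd n ((1 / \<sigma>\<^sup>2) \<cdot>\<^sub>m ?A)" using assms by (intro spd_smult spd_one_minus_P) auto
  have "(\<integral>\<^sup>+y. ennreal (exp (log_ratio \<sigma> \<alpha> t \<mu> y)) \<partial>mvn \<mu> (\<sigma>\<^sup>2 \<cdot>\<^sub>m 1\<^sub>m n))
    = (\<integral>\<^sup>+y. ennreal (mvn_density \<mu> (\<sigma>\<^sup>2 \<cdot>\<^sub>m 1\<^sub>m n) y) * ennreal (exp (log_ratio \<sigma> \<alpha> t \<mu> y)) \<partial>lborel_vec n)"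
    using measurable_log_ratio[OF \<mu>] assms(1) \<mu>
    by (intro nn_integral_mvn) (auto simp: mat_inv_smult_one)
  also have "\<dots> \<le> (\<integral>\<^sup>+y. ennreal (1 / ?c) * ennreal (exp (- ((y - ?\<nu>) \<bullet> (((1 / \<sigma>\<^sup>2) \<cdot>\<^sub>m ?A) *\<^sub>v (y - ?\<nu>))) / 2)) \<partial>lborel_vec n)"
  proof (rule nn_integral_mono)
    fix y assume "y \<in> space (lborel_vec n)"
    then have y: "y \<in> carrier_vec n" by simp
    have "(y - ?\<nu>) \<bullet> (((1 / \<sigma>\<^sup>2) \<cdot>\<^sub>m ?A) *\<^sub>v (y - ?\<nu>)) = (1 / \<sigma>\<^sup>2) * ((y - ?\<nu>) \<bullet> (?A *\<^sub>v (y - ?\<nu>)))"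
      using y \<nu> Ac by (simp add: smult_mat_mult_vec[of _ n n])
    moreover have "log_ratio \<sigma> \<alpha> t \<mu> y - (y - \<mu>) \<bullet> (y - \<mu>) / (2 * \<sigma>\<^sup>2)
      \<le> - ((y - ?\<nu>) \<bullet> (?A *\<^sub>v (y - ?\<nu>))) / 2 / \<sigma>\<^sup>2"
      using divide_right_mono[OF exponent_le[OF y \<mu> t(3)], of "\<sigma>\<^sup>2"]
      unfolding log_ratio_def by (simp add: diff_divide_distrib)
    ultimately have le: "log_ratio \<sigma> \<alpha> t \<mu> y - (y - \<mu>) \<bullet> (y - \<mu>) / (2 * \<sigma>\<^sup>2)
      \<le> - ((y - ?\<nu>) \<bullet> (((1 / \<sigma>\<^sup>2) \<cdot>\<^sub>m ?A) *\<^sub>v (y - ?\<nu>))) / 2" by simp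
    have exp_minus_eq: "exp (L - q / s) = exp L * exp (- q / s)" for L q s :: real
      by (simp flip: exp_add)
    have "mvn_density \<mu> (\<sigma>\<^sup>2 \<cdot>\<^sub>m 1\<^sub>m n) y * exp (log_ratio \<sigma> \<alpha> t \<mu> y)
      = 1 / ?c * exp (log_ratio \<sigma> \<alpha> t \<mu> y - (y - \<mu>) \<bullet> (y - \<mu>) / (2 * \<sigma>\<^sup>2))"
      unfolding mvn_density_smult_one[OF assms(1) \<mu> y] exp_minus_eq by simp
    also have "\<dots> \<le> 1 / ?c * exp (- ((y - ?\<nu>) \<bullet> (((1 / \<sigma>\<^sup>2) \<cdot>\<^sub>m ?A) *\<^sub>v (y - ?\<nu>))) / 2)"
      using le by (intro mult_left_mono) auto
    finally show "ennreal (mvn_density \<mu> (\<sigma>\<^sup>2 \<cdot>\<^sub>m 1\<^sub>m n) y) * ennreal (exp (log_ratio \<sigma> \<alpha> t \<mu> y))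
      \<le> ennreal (1 / ?c) * ennreal (exp (- ((y - ?\<nu>) \<bullet> (((1 / \<sigma>\<^sup>2) \<cdot>\<^sub>m ?A) *\<^sub>v (y - ?\<nu>))) / 2))"
      using assms(1) by (simp only: ennreal_mult''[symmetric] exp_ge_zero) (rule ennreal_leI)
  qed
  also have "\<dots> = ennreal (1 / ?c) * ennreal (sqrt ((2 * pi) ^ n / det ((1 / \<sigma>\<^sup>2) \<cdot>\<^sub>m ?A)))"
  proof -
    have "(\<lambda>y. (y - ?\<nu>) \<bullet> (((1 / \<sigma>\<^sup>2) \<cdot>\<^sub>m ?A) *\<^sub>v (y - ?\<nu>))) \<in> borel_measurable (lborel_vec n)"
      using \<nu> Ac by (intro measurable_scalar_prod[of _ _ n] measurable_minus_vec measurable_const_vec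
        measurable_mult_mat_vec[of _ n n]) auto
    then show ?thesis using nn_integral_gaussian[OF A \<nu>] by (subst nn_integral_cmult) auto
  qed
  also have "det ((1 / \<sigma>\<^sup>2) \<cdot>\<^sub>m ?A) = (1 - ?l) ^ card S / (\<sigma>\<^sup>2) ^ n"
    using P det_one_minus_P[of ?l] by (simp add: power_divide power_one_over)
  also have "ennreal (1 / ?c) * ennreal (sqrt ((2 * pi) ^ n / ((1 - ?l) ^ card S / (\<sigma>\<^sup>2) ^ n)))
     = ennreal (sqrt (1 / (1 - ?l) ^ card S))"
  proof -
    have *: "(2 * pi) ^ n / ((1 - ?l) ^ card S / (\<sigma>\<^sup>2) ^ n) = (2 * pi * \<sigma>\<^sup>2) ^ n * (1 / (1 - ?l) ^ card S)"
      by (simp add: power_mult_distrib)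
    have "1 / ?c * sqrt ((2 * pi) ^ n / ((1 - ?l) ^ card S / (\<sigma>\<^sup>2) ^ n)) = sqrt (1 / (1 - ?l) ^ card S)"
      unfolding * real_sqrt_mult using assms(1) by simp
    moreover have "0 \<le> 1 / ?c" by simp
    ultimately show ?thesis by (metis ennreal_mult')
  qed
  finally show ?thesis .
qed

end

subsection \<open>Expected posterior mass\<close>

lemma size_prior_nonneg: "c > 0 \<Longrightarrow> size_prior a c p R s \<ge> 0"
  by (auto simp: size_prior_def intro!: divide_nonneg_nonneg sum_nonneg)

lemma model_prior_nonneg: "c > 0 \<Longrightarrow> model_prior a c X S \<ge> 0"
  by (auto simp: model_prior_def size_prior_nonneg)

lemma sets_unnorm_posterior: "sets (unnorm_posterior \<sigma> \<alpha> \<gamma> a c X y) = sets (lborel_vec (dim_col X))"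
  by (simp add: unnorm_posterior_def)

lemma emeasure_posterior:
  "emeasure (posterior \<sigma> \<alpha> \<gamma> a c X y) A =
    inverse (emeasure (unnorm_posterior \<sigma> \<alpha> \<gamma> a c X y) (carrier_vec (dim_col X)))
    * emeasure (unnorm_posterior \<sigma> \<alpha> \<gamma> a c X y) A"
proof -
  have "space (unnorm_posterior \<sigma> \<alpha> \<gamma> a c X y) = carrier_vec (dim_col X)"
    using sets_eq_imp_space_eq[OF sets_unnorm_posterior] by simp
  then show ?thesis unfolding posterior_def Let_def by simp
qed

lemma evidence_total_ge:
  assumes "\<sigma> > 0" "\<gamma> > 0" "\<alpha> \<ge> 0" "c > 0"
    and X: "X \<in> carrier_mat n p" and y: "y \<in> carrier_vec n" and \<beta>: "\<beta>' \<in> carrier_vec p"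
    and inv: "invertible_mat (gram X (supp \<beta>'))"
  shows "ennreal (model_prior a c X (supp \<beta>') * (response_density X \<sigma> \<beta>' y powr \<alpha> * sqrt (1 / (1 + \<alpha> / \<gamma>) ^ card (supp \<beta>'))))
    \<le> emeasure (unnorm_posterior \<sigma> \<alpha> \<gamma> a c X y) (carrier_vec p)"
proof -
  let ?S = "supp \<beta>'"
  have S: "?S \<in> Pow {..<p}" using \<beta> by (auto simp: supp_def)
  interpret submodel X ?S n p using X inv S by unfold_locales auto
  have sp: "carrier_vec p = space (lborel_vec p)" by simp
  have "ennreal (model_prior a c X ?S * (response_density X \<sigma> \<beta>' y powr \<alpha> * sqrt (1 / (1 + \<alpha> / \<gamma>) ^ card ?S)))
    = ennreal (model_prior a c X ?S) * ennreal (response_density X \<sigma> \<beta>' y powr \<alpha> * sqrt (1 / (1 + \<alpha> / \<gamma>) ^ card ?S))"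
    using model_prior_nonneg[OF assms(4)] by (rule ennreal_mult')
  also have "\<dots> \<le> ennreal (model_prior a c X ?S) *
      (\<integral>\<^sup>+\<beta>. ennreal (response_density X \<sigma> \<beta> y powr \<alpha>) \<partial>model_component \<sigma> \<gamma> X y ?S)"
    using assms by (intro mult_left_mono evidence_ge) auto
  also have "(\<integral>\<^sup>+\<beta>. ennreal (response_density X \<sigma> \<beta> y powr \<alpha>) \<partial>model_component \<sigma> \<gamma> X y ?S) =
    (\<integral>\<^sup>+\<beta>. ennreal (response_density X \<sigma> \<beta> y powr \<alpha>) * indicator (carrier_vec p) \<beta> \<partial>model_component \<sigma> \<gamma> X y ?S)"
    using X sets_eq_imp_space_eq[OF sets_model_component[of \<sigma> \<gamma> X y ?S]] by (intro nn_integral_cong) simp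
  also have "ennreal (model_prior a c X ?S) * \<dots> \<le> emeasure (unnorm_posterior \<sigma> \<alpha> \<gamma> a c X y) (carrier_vec p)"
    using S sets.top[of "lborel_vec p"]
    by (subst emeasure_unnorm_posterior[OF assms(1) X y])
       (auto intro!: member_le_sum[of ?S _ "\<lambda>S. ennreal (model_prior a c X S) *
       (\<integral>\<^sup>+\<beta>. ennreal (response_density X \<sigma> \<beta> y powr \<alpha>) * indicator (carrier_vec p) \<beta> \<partial>model_component \<sigma> \<gamma> X y S)"])
  finally show ?thesis .
qed

text \<open>The likelihood of \<beta>' occurs in the bounds for numerator and evidence alike and
  cancels, leaving prior odds against the true model. Only models of positive prior mass are summed,
  since invertible Gram matrices are assumed for these.\<close>

lemma emeasure_posterior_le:
  assumes "\<sigma> > 0" "\<gamma> > 0" "c > 0" and t: "0 \<le> t" "4 * t \<le> \<alpha>"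
    and X: "X \<in> carrier_mat n p" and y: "y \<in> carrier_vec n" and \<beta>: "\<beta>' \<in> carrier_vec p"
    and pos: "model_prior a c X (supp \<beta>') > 0"
    and inv: "\<And>S. model_prior a c X S > 0 \<Longrightarrow> invertible_mat (gram X S)"
    and \<tau>: "\<And>\<beta>. \<beta> \<in> carrier_vec p \<Longrightarrow> \<beta> \<in> A \<Longrightarrow>
      \<tau> \<le> t * ((X *\<^sub>v \<beta> - X *\<^sub>v \<beta>') \<bullet> (X *\<^sub>v \<beta> - X *\<^sub>v \<beta>')) / \<sigma>\<^sup>2"
  defines "\<kappa> \<equiv> model_prior a c X (supp \<beta>') * sqrt (1 / (1 + \<alpha> / \<gamma>) ^ card (supp \<beta>'))"
  shows "emeasure (posterior \<sigma> \<alpha> \<gamma> a c X y) A \<le>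
    (\<Sum>S | S \<subseteq> {..<p} \<and> model_prior a c X S > 0.
      ennreal (model_prior a c X S / \<kappa> * exp (- \<tau>)) * ennreal (exp (submodel.log_ratio X S \<sigma> \<alpha> t (X *\<^sub>v \<beta>') y)))"
proof (cases "A \<in> sets (lborel_vec p)")
  case False
  \<comment> \<open>\<open>emeasure\<close> is 0 outside the sigma-algebra, so a non-measurable
    event satisfies the bound trivially.\<close>
  then have "A \<notin> sets (posterior \<sigma> \<alpha> \<gamma> a c X y)"
    using X by (simp add: posterior_def Let_def sets_unnorm_posterior)
  then show ?thesis by (simp add: emeasure_notin_sets)
next
  case A: True
  let ?U = "unnorm_posterior \<sigma> \<alpha> \<gamma> a c X y"
  let ?L = "response_density X \<sigma> \<beta>' y powr \<alpha>"
  let ?I = "{S. S \<subseteq> {..<p} \<and> model_prior a c X S > 0}"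
  have L: "?L > 0" using assms(1) by (simp add: response_density_eq[OF _ X \<beta> y])
  have \<kappa>: "\<kappa> > 0" unfolding \<kappa>_def using pos t assms(2)
    by (intro mult_pos_pos) (auto intro!: divide_pos_pos zero_less_power add_pos_nonneg)
  have D: "ennreal (\<kappa> * ?L) \<le> emeasure ?U (carrier_vec p)"
    using evidence_total_ge[OF assms(1,2) _ assms(3) X y \<beta> inv[OF pos], of \<alpha> a] t
    by (simp add: \<kappa>_def mult_ac)
  have N: "emeasure ?U A \<le> (\<Sum>S\<in>?I. ennreal (model_prior a c X S) *
      ennreal (?L * exp (- \<tau>) * exp (submodel.log_ratio X S \<sigma> \<alpha> t (X *\<^sub>v \<beta>') y)))"
  proof -
    have "emeasure ?U A = (\<Sum>S\<in>Pow {..<p}. ennreal (model_prior a c X S) *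
       (\<integral>\<^sup>+\<beta>. ennreal (response_density X \<sigma> \<beta> y powr \<alpha>) * indicator A \<beta> \<partial>model_component \<sigma> \<gamma> X y S))"
      by (rule emeasure_unnorm_posterior[OF assms(1) X y A])
    also have "\<dots> = (\<Sum>S\<in>?I. ennreal (model_prior a c X S) *
       (\<integral>\<^sup>+\<beta>. ennreal (response_density X \<sigma> \<beta> y powr \<alpha>) * indicator A \<beta> \<partial>model_component \<sigma> \<gamma> X y S))"
      by (intro sum.mono_neutral_right) (auto simp: not_less ennreal_neg)
    also have "\<dots> \<le> (\<Sum>S\<in>?I. ennreal (model_prior a c X S) *
      ennreal (?L * exp (- \<tau>) * exp (submodel.log_ratio X S \<sigma> \<alpha> t (X *\<^sub>v \<beta>') y)))"
    proof (intro sum_mono mult_left_mono)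
      fix S assume S: "S \<in> ?I"
      interpret submodel X S n p using X inv S by unfold_locales auto
      have AC: "A \<subseteq> carrier_vec p" using sets.sets_into_space[OF A] by simp
      show "(\<integral>\<^sup>+\<beta>. ennreal (response_density X \<sigma> \<beta> y powr \<alpha>) * indicator A \<beta> \<partial>model_component \<sigma> \<gamma> X y S)
        \<le> ennreal (?L * exp (- \<tau>) * exp (log_ratio \<sigma> \<alpha> t (X *\<^sub>v \<beta>') y))"
        using AC by (intro nn_integral_component_le[OF assms(1,2) t y \<beta> A] \<tau>) auto
    qed simp
    finally show ?thesis .
  qed
  have "emeasure (posterior \<sigma> \<alpha> \<gamma> a c X y) A = inverse (emeasure ?U (carrier_vec p)) * emeasure ?U A"
    using X by (simp add: emeasure_posterior)
  also have "\<dots> \<le> inverse (ennreal (\<kappa> * ?L)) * emeasure ?U A"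
  proof (intro mult_right_mono)
    show "inverse (emeasure ?U (carrier_vec p)) \<le> inverse (ennreal (\<kappa> * ?L))"
    proof (cases "emeasure ?U (carrier_vec p)" rule: ennreal_cases)
      case (real d)
      then have "\<kappa> * ?L \<le> d" using D by simp
      moreover have pos: "\<kappa> * ?L > 0" using \<kappa> L by (rule mult_pos_pos)
      ultimately have "inverse d \<le> inverse (\<kappa> * ?L)" "0 < d"
        by (rule le_imp_inverse_le, linarith)
      then show ?thesis
        unfolding real inverse_ennreal[OF \<open>0 < d\<close>] inverse_ennreal[OF pos] by (intro ennreal_leI)
    qed simp
  qed simp
  also have "\<dots> \<le> inverse (ennreal (\<kappa> * ?L)) * (\<Sum>S\<in>?I. ennreal (model_prior a c X S) *
      ennreal (?L * exp (- \<tau>) * exp (submodel.log_ratio X S \<sigma> \<alpha> t (X *\<^sub>v \<beta>') y)))"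
    using N by (rule mult_left_mono) simp
  also have "\<dots> = (\<Sum>S\<in>?I. ennreal (model_prior a c X S / \<kappa> * exp (- \<tau>)) * ennreal (exp (submodel.log_ratio X S \<sigma> \<alpha> t (X *\<^sub>v \<beta>') y)))"
  proof -
    have "inverse (ennreal (\<kappa> * ?L)) * (ennreal (model_prior a c X S) * ennreal (?L * exp (- \<tau>) * e))
      = ennreal (model_prior a c X S / \<kappa> * exp (- \<tau>)) * ennreal e" if "e > 0" for S e
      using L \<kappa> that model_prior_nonneg[OF assms(3), of a X S]
      by (simp add: inverse_ennreal ennreal_mult'[symmetric] ennreal_mult''[symmetric] field_simps)
    then show ?thesis unfolding sum_distrib_left by (intro sum.cong refl) simp
  qed
  finally show ?thesis .
qed

text \<open>The sum over models dominates the posterior mass for every \<open>y\<close>. The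
  nonnegative integral is monotone for arbitrary integrands, so measurability in \<open>y\<close> is
  checked for the dominating sum alone.\<close>

lemma nn_integral_posterior_le:
  assumes "\<sigma> > 0" "\<gamma> > 0" "c > 0"
    and t: "0 \<le> t" "4 * t \<le> \<alpha>" "2 * t \<le> \<alpha> * (1 - \<alpha>)" "4 * t + \<alpha> < 1"
    and X: "X \<in> carrier_mat n p" and \<beta>: "\<beta>' \<in> carrier_vec p"
    and pos: "model_prior a c X (supp \<beta>') > 0"
    and inv: "\<And>S. model_prior a c X S > 0 \<Longrightarrow> invertible_mat (gram X S)"
    and \<tau>: "\<And>\<beta>. \<beta> \<in> carrier_vec p \<Longrightarrow> \<beta> \<in> A \<Longrightarrow>
      \<tau> \<le> t * ((X *\<^sub>v \<beta> - X *\<^sub>v \<beta>') \<bullet> (X *\<^sub>v \<beta> - X *\<^sub>v \<beta>')) / \<sigma>\<^sup>2"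
  defines "\<kappa> \<equiv> model_prior a c X (supp \<beta>') * sqrt (1 / (1 + \<alpha> / \<gamma>) ^ card (supp \<beta>'))"
  shows "(\<integral>\<^sup>+y. emeasure (posterior \<sigma> \<alpha> \<gamma> a c X y) A \<partial>response_dist X \<sigma> \<beta>') \<le>
    ennreal ((\<Sum>S\<in>Pow {..<p}. model_prior a c X S * sqrt (1 / (1 - (4 * t + \<alpha>))) ^ card S) / \<kappa> * exp (- \<tau>))"
proof -
  let ?\<mu> = "X *\<^sub>v \<beta>'"
  let ?I = "{S. S \<subseteq> {..<p} \<and> model_prior a c X S > 0}"
  let ?r = "sqrt (1 / (1 - (4 * t + \<alpha>)))"
  have \<mu>: "?\<mu> \<in> carrier_vec n" using X \<beta> by simp
  have rd: "response_dist X \<sigma> \<beta>' = mvn ?\<mu> (\<sigma>\<^sup>2 \<cdot>\<^sub>m 1\<^sub>m n)" using X by (simp add: response_dist_def)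
  have sp: "space (mvn ?\<mu> (\<sigma>\<^sup>2 \<cdot>\<^sub>m 1\<^sub>m n)) = carrier_vec n" using X by (simp add: mvn_def)
  have bm: "borel_measurable (mvn ?\<mu> (\<sigma>\<^sup>2 \<cdot>\<^sub>m 1\<^sub>m n)) = borel_measurable (lborel_vec n)"
    using X by (intro measurable_cong_sets) auto
  have \<kappa>: "\<kappa> > 0" unfolding \<kappa>_def using pos t assms(2)
    by (intro mult_pos_pos) (auto intro!: divide_pos_pos zero_less_power add_pos_nonneg)
  have \<alpha>: "\<alpha> \<ge> 0" using t by linarith
  have meas: "(\<lambda>y. ennreal (exp (submodel.log_ratio X S \<sigma> \<alpha> t ?\<mu> y))) \<in> borel_measurable (lborel_vec n)"
    and le: "(\<integral>\<^sup>+y. ennreal (exp (submodel.log_ratio X S \<sigma> \<alpha> t ?\<mu> y)) \<partial>mvn ?\<mu> (\<sigma>\<^sup>2 \<cdot>\<^sub>m 1\<^sub>m n)) \<le> ennreal (?r ^ card S)"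
    if S: "S \<in> ?I" for S
  proof -
    interpret submodel X S n p using X inv S by unfold_locales auto
    show "(\<lambda>y. ennreal (exp (log_ratio \<sigma> \<alpha> t ?\<mu> y))) \<in> borel_measurable (lborel_vec n)"
      using measurable_log_ratio[OF \<mu>] by simp
    show "(\<integral>\<^sup>+y. ennreal (exp (log_ratio \<sigma> \<alpha> t ?\<mu> y)) \<partial>mvn ?\<mu> (\<sigma>\<^sup>2 \<cdot>\<^sub>m 1\<^sub>m n)) \<le> ennreal (?r ^ card S)"
      using nn_integral_exp_log_ratio_le[OF assms(1) t(1) \<alpha> t(3,4) \<mu>]
      by (simp add: real_sqrt_power[symmetric] power_one_over)
  qed
  have "(\<integral>\<^sup>+y. emeasure (posterior \<sigma> \<alpha> \<gamma> a c X y) A \<partial>response_dist X \<sigma> \<beta>') \<le>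
    (\<integral>\<^sup>+y. (\<Sum>S\<in>?I. ennreal (model_prior a c X S / \<kappa> * exp (- \<tau>)) *
      ennreal (exp (submodel.log_ratio X S \<sigma> \<alpha> t ?\<mu> y))) \<partial>mvn ?\<mu> (\<sigma>\<^sup>2 \<cdot>\<^sub>m 1\<^sub>m n))"
    unfolding rd \<kappa>_def
    by (intro nn_integral_mono emeasure_posterior_le[OF assms(1-3) t(1,2) X _ \<beta> pos inv \<tau>]) (auto simp: sp)
  also have "\<dots> = (\<Sum>S\<in>?I. ennreal (model_prior a c X S / \<kappa> * exp (- \<tau>)) *
      (\<integral>\<^sup>+y. ennreal (exp (submodel.log_ratio X S \<sigma> \<alpha> t ?\<mu> y)) \<partial>mvn ?\<mu> (\<sigma>\<^sup>2 \<cdot>\<^sub>m 1\<^sub>m n)))"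
    using meas by (subst nn_integral_sum) (auto simp: bm nn_integral_cmult intro!: sum.cong)
  also have "\<dots> \<le> (\<Sum>S\<in>?I. ennreal (model_prior a c X S / \<kappa> * exp (- \<tau>)) * ennreal (?r ^ card S))"
    using le by (intro sum_mono mult_left_mono) auto
  also have "\<dots> = ennreal (\<Sum>S\<in>?I. model_prior a c X S / \<kappa> * exp (- \<tau>) * ?r ^ card S)"
    using \<kappa> t
    by (subst sum_ennreal[symmetric]) (auto simp: ennreal_mult''[symmetric] intro!: sum.cong)
  \<comment> \<open>Models of prior mass zero are put back, giving a sum over all subsets that can
    be grouped by size.\<close>
  also have "(\<Sum>S\<in>?I. model_prior a c X S / \<kappa> * exp (- \<tau>) * ?r ^ card S)
     = (\<Sum>S\<in>Pow {..<p}. model_prior a c X S / \<kappa> * exp (- \<tau>) * ?r ^ card S)"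
    using model_prior_nonneg[OF assms(3), of a X]
    by (intro sum.mono_neutral_left) (auto simp: less_le)
  also have "\<dots> = (\<Sum>S\<in>Pow {..<p}. model_prior a c X S * ?r ^ card S) / \<kappa> * exp (- \<tau>)"
    unfolding sum_divide_distrib sum_distrib_right by (intro sum.cong refl) simp
  finally show ?thesis .
qed

text \<open>Serves the finitely many sample sizes that the asymptotic estimates do not reach. The
  response distribution has mass 1 by the chi-square transform at weight 0.\<close>

lemma nn_integral_posterior_le_1:
  assumes "\<sigma> > 0" "X \<in> carrier_mat n p" "\<beta>' \<in> carrier_vec p"
  shows "(\<integral>\<^sup>+y. emeasure (posterior \<sigma> \<alpha> \<gamma> a c X y) A \<partial>response_dist X \<sigma> \<beta>') \<le> 1"
proof -
  have "(\<integral>\<^sup>+y. emeasure (posterior \<sigma> \<alpha> \<gamma> a c X y) A \<partial>response_dist X \<sigma> \<beta>')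
    \<le> (\<integral>\<^sup>+y. 1 \<partial>response_dist X \<sigma> \<beta>')"
    by (intro nn_integral_mono emeasure_posterior_le_1)
  also have "\<dots> = (\<integral>\<^sup>+y. ennreal (exp (- 0 * ((y - X *\<^sub>v \<beta>') \<bullet> (((1 / \<sigma>\<^sup>2) \<cdot>\<^sub>m 1\<^sub>m n) *\<^sub>v (y - X *\<^sub>v \<beta>'))) / 2)) \<partial>mvn (X *\<^sub>v \<beta>') (\<sigma>\<^sup>2 \<cdot>\<^sub>m 1\<^sub>m n))"
    using assms by (simp add: response_dist_def)
  also have "\<dots> = ennreal (sqrt (1 / (1 + 0) ^ n))"
    using assms spd_smult[OF spd_one[of n], of "1 / \<sigma>\<^sup>2"]
    by (intro nn_integral_mvn_exp_mahalanobis)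
       (auto simp: mult_smult_assoc_mat[of _ n n _ n] mult_smult_distrib[of _ n n _ n])
  finally show ?thesis by simp
qed

subsection \<open>Hellinger distance\<close>

text \<open>The geometric mean of two normal densities of equal variance is \<open>?e\<close> times
  the density centred midway. The squared distance is therefore \<open>2 - 2 * ?e\<close>, bounded
  through \<open>1 + x \<le> exp x\<close>.\<close>

lemma hellinger_normal_sq_le:
  assumes "\<sigma> > 0"
  shows "(hellinger (normal_density m \<sigma>) (normal_density m' \<sigma>))\<^sup>2 \<le> (m - m')\<^sup>2 / (4 * \<sigma>\<^sup>2)"
proof -
  let ?f = "normal_density m \<sigma>" and ?g = "normal_density m' \<sigma>" and ?h = "normal_density ((m + m') / 2) \<sigma>"
  let ?e = "exp (- ((m - m')\<^sup>2 / (8 * \<sigma>\<^sup>2)))"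
  have mid: "sqrt (?f u) * sqrt (?g u) = ?e * ?h u" for u
  proof -
    have "?f u * ?g u = (?e * ?h u)\<^sup>2"
    proof -
      have "- (u - m)\<^sup>2 / (2 * \<sigma>\<^sup>2) + - (u - m')\<^sup>2 / (2 * \<sigma>\<^sup>2)
        = 2 * (- ((m - m')\<^sup>2 / (8 * \<sigma>\<^sup>2)) + - (u - (m + m') / 2)\<^sup>2 / (2 * \<sigma>\<^sup>2))"
        using assms by (simp add: field_simps power2_eq_square)
      then show ?thesis unfolding normal_density_def
        by (simp add: power2_eq_square exp_add[symmetric] flip: exp_double)
    qed
    then have "sqrt (?f u * ?g u) = ?e * ?h u"
      by (simp add: normal_density_nonneg)
    then show ?thesis by (simp add: real_sqrt_mult)
  qed
  have "(sqrt (?f u) - sqrt (?g u))\<^sup>2 = ?f u + ?g u - 2 * ?e * ?h u" for u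
    using mid[of u] by (simp add: power2_diff normal_density_nonneg)
  then have "(\<integral>u. (sqrt (?f u) - sqrt (?g u))\<^sup>2 \<partial>lborel) = 2 - 2 * ?e"
    using assms by (simp add: integrable_normal_density integral_normal_density)
  moreover have "1 + - ((m - m')\<^sup>2 / (8 * \<sigma>\<^sup>2)) \<le> ?e" by (rule exp_ge_add_one_self)
  \<comment> \<open>Makes \<open>2 - 2 * ?e\<close> nonnegative, so that squaring undoes the square
    root.\<close>
  moreover have "?e \<le> 1" by simp
  ultimately show ?thesis unfolding hellinger_def by (simp add: field_simps)
qed

text \<open>Row \<open>i\<close> is charged the squared \<open>i\<close>-th entry of the difference
  of predictions, so averaging over rows gives a rescaled squared norm. The uniform distribution on
  row indices requires a nonempty index set, hence \<open>n \<ge> 1\<close>.\<close>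

lemma mean_hellinger_sq_le:
  assumes "\<sigma> > 0" and X: "X \<in> carrier_mat n p" and n: "n \<ge> 1"
    and \<beta>: "\<beta> \<in> carrier_vec p" "\<beta>' \<in> carrier_vec p"
  shows "(mean_hellinger \<sigma> X \<beta>' \<beta>)\<^sup>2 \<le> ((X *\<^sub>v \<beta> - X *\<^sub>v \<beta>') \<bullet> (X *\<^sub>v \<beta> - X *\<^sub>v \<beta>')) / (4 * \<sigma>\<^sup>2 * real n)"
proof -
  have ne: "{..<n} \<noteq> {}" using n by (auto simp: lessThan_empty_iff)
  have E: "measure_pmf.expectation (row_dist X) (\<lambda>x. (pred_hellinger \<sigma> x \<beta>' \<beta>)\<^sup>2)
    = (\<Sum>i<n. (pred_hellinger \<sigma> (row X i) \<beta>' \<beta>)\<^sup>2) / real n"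
    using X ne by (simp add: row_dist_def integral_map_pmf integral_pmf_of_set)
  have "(\<Sum>i<n. (pred_hellinger \<sigma> (row X i) \<beta>' \<beta>)\<^sup>2) \<le> (\<Sum>i<n. ((X *\<^sub>v \<beta> - X *\<^sub>v \<beta>') $ i * (X *\<^sub>v \<beta> - X *\<^sub>v \<beta>') $ i) / (4 * \<sigma>\<^sup>2))"
  proof (rule sum_mono)
    fix i assume "i \<in> {..<n}"
    then have "(X *\<^sub>v \<beta> - X *\<^sub>v \<beta>') $ i = row X i \<bullet> \<beta> - row X i \<bullet> \<beta>'" using X by simp
    then show "(pred_hellinger \<sigma> (row X i) \<beta>' \<beta>)\<^sup>2 \<le> ((X *\<^sub>v \<beta> - X *\<^sub>v \<beta>') $ i * (X *\<^sub>v \<beta> - X *\<^sub>v \<beta>') $ i) / (4 * \<sigma>\<^sup>2)"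
      using hellinger_normal_sq_le[OF assms(1), of "row X i \<bullet> \<beta>" "row X i \<bullet> \<beta>'"]
      by (simp add: pred_hellinger_def power2_eq_square)
  qed
  also have "\<dots> = ((X *\<^sub>v \<beta> - X *\<^sub>v \<beta>') \<bullet> (X *\<^sub>v \<beta> - X *\<^sub>v \<beta>')) / (4 * \<sigma>\<^sup>2)"
    using X by (simp add: scalar_prod_def atLeast0LessThan sum_divide_distrib)
  finally have "(\<Sum>i<n. (pred_hellinger \<sigma> (row X i) \<beta>' \<beta>)\<^sup>2) / real n
    \<le> ((X *\<^sub>v \<beta> - X *\<^sub>v \<beta>') \<bullet> (X *\<^sub>v \<beta> - X *\<^sub>v \<beta>')) / (4 * \<sigma>\<^sup>2) / real n"
    by (rule divide_right_mono) simp
  moreover have "(\<Sum>i<n. (pred_hellinger \<sigma> (row X i) \<beta>' \<beta>)\<^sup>2) / real n \<ge> 0"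
    by (intro divide_nonneg_nonneg sum_nonneg) auto
  ultimately show ?thesis unfolding mean_hellinger_def E by simp
qed

subsection \<open>Prior mass\<close>

lemma sum_Pow_card:
  assumes "finite B"
  shows "(\<Sum>S\<in>Pow B. f (card S)) = (\<Sum>k\<le>card B. real (card B choose k) * f k)"
proof -
  have "(\<Sum>S\<in>Pow B. f (card S)) = (\<Sum>k\<in>{..card B}. \<Sum>S\<in>{S \<in> Pow B. card S = k}. f (card S))"
    using assms by (intro sum.group[symmetric]) (auto intro: card_mono)
  also have "\<dots> = (\<Sum>k\<le>card B. real (card B choose k) * f k)"
    using n_subsets[OF assms] by (intro sum.cong refl) (simp add: Collect_conj_eq)
  finally show ?thesis .
qed

lemma sum_power_le_2:
  assumes "0 \<le> x" "x \<le> (1/2 :: real)"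
  shows "(\<Sum>k\<le>m. x ^ k) \<le> 2"
proof -
  have "(\<Sum>k\<le>m. x ^ k) \<le> 1 / (1 - x)"
    using assms sum_le_suminf[of "\<lambda>k. x ^ k" "{..m}"] by (simp add: suminf_geometric summable_geometric)
  also have "\<dots> \<le> 2" using assms by (simp add: field_simps)
  finally show ?thesis .
qed

text \<open>The constant \<open>Z\<close> cancels in the ratio. In the sum the binomial weight
  cancels against the number of models of each size, leaving a geometric series with ratio
  \<open>r / q \<le> 1 / 2\<close>; truncation at the rank only lowers it.\<close>

lemma prior_sum_ratio_le:
  fixes X :: "real mat" and a c r :: real
  defines "q \<equiv> c * real (dim_col X) powr a"
  assumes r: "0 \<le> r" "2 * r \<le> q" "0 < q" and S': "S' \<subseteq> {..<dim_col X}" "card S' \<le> mat_rank X"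
  shows "model_prior a c X S' > 0"
    and "(\<Sum>S\<in>Pow {..<dim_col X}. model_prior a c X S * r ^ card S) / model_prior a c X S'
      \<le> 2 * (real (dim_col X) * q) ^ card S'"
proof -
  let ?p = "dim_col X" and ?R = "mat_rank X"
  define Z where "Z = (\<Sum>t\<le>?R. inverse (q ^ t))"
  have Z: "Z > 0" unfolding Z_def using r by (intro sum_pos) auto
  have sz: "size_prior a c ?p ?R k = (if k \<le> ?R then inverse (q ^ k) / Z else 0)" for k
    by (simp add: size_prior_def q_def Z_def)
  have card_le: "card S' \<le> ?p" using card_mono[OF _ S'(1)] by simp
  have ch: "real (?p choose card S') > 0" using card_le by (simp add: zero_less_binomial)
  have \<pi>': "model_prior a c X S' = 1 / (real (?p choose card S') * q ^ card S' * Z)"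
    using S' by (simp add: model_prior_def sz divide_simps)
  then show "model_prior a c X S' > 0" using ch r Z by simp
  let ?g = "\<lambda>k. inverse (real (?p choose k)) * size_prior a c ?p ?R k * r ^ k"
  have "(\<Sum>S\<in>Pow {..<?p}. model_prior a c X S * r ^ card S) = (\<Sum>S\<in>Pow {..<?p}. ?g (card S))"
    by (intro sum.cong refl) (auto simp: model_prior_def size_prior_def)
  also have "\<dots> = (\<Sum>k\<le>?p. real (?p choose k) * ?g k)"
    using sum_Pow_card[of "{..<?p}" ?g] by simp
  also have "\<dots> = (\<Sum>k\<le>?p. size_prior a c ?p ?R k * r ^ k)"
    by (intro sum.cong refl) simp
  also have "\<dots> \<le> (\<Sum>k\<le>?p. (r / q) ^ k / Z)"
    using r Z by (intro sum_mono) (auto simp: sz power_divide divide_simps)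
  also have "\<dots> = (\<Sum>k\<le>?p. (r / q) ^ k) / Z" by (simp add: sum_divide_distrib)
  also have "\<dots> \<le> 2 / Z" using r Z by (intro divide_right_mono sum_power_le_2) (auto simp: field_simps)
  finally have "(\<Sum>S\<in>Pow {..<?p}. model_prior a c X S * r ^ card S) / model_prior a c X S'
     \<le> (2 / Z) / model_prior a c X S'"
    using ch r Z by (intro divide_right_mono) (auto simp: \<pi>')
  also have "\<dots> = 2 * (real (?p choose card S') * q ^ card S')" using ch r Z by (simp add: \<pi>')
  also have "\<dots> \<le> 2 * (real ?p ^ card S' * q ^ card S')"
  proof -
    have "?p choose card S' \<le> ?p ^ card S'" using card_le by (rule binomial_le_pow)
    then have "real (?p choose card S') \<le> real ?p ^ card S'" by (metis of_nat_le_iff of_nat_power)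
    then show ?thesis using r by simp
  qed
  finally show "(\<Sum>S\<in>Pow {..<?p}. model_prior a c X S * r ^ card S) / model_prior a c X S'
      \<le> 2 * (real ?p * q) ^ card S'" by (simp add: power_mult_distrib)
qed

subsection \<open>Posterior concentration\<close>

text \<open>The threshold for the exponent is \<open>4 * t * M\<^sup>2 * v\<close>, its 4 being that
  of the Hellinger bound. In the base of the power, \<open>p\<close> pays for the number of models
  of size \<open>s\<close>, \<open>q\<close> for the size prior and the square root for the
  evidence. Full rank and \<open>s \<le> n\<close> give the true model positive prior mass.\<close>

lemma nn_integral_posterior_tail_le:
  fixes X :: "real mat" and n p s :: nat and \<sigma> \<alpha> \<gamma> a c M :: real
  defines "q \<equiv> c * real p powr a" and "v \<equiv> real s * ln (real p / real s)"
  defines "t \<equiv> \<alpha> * (1 - \<alpha>) / 8"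
  assumes "\<sigma> > 0" "0 < \<alpha>" "\<alpha> < 1" "\<gamma> > 0" "c > 0"
    and n: "n \<ge> 1" and X: "X \<in> carrier_mat n p" and rank: "mat_rank X = n"
    and inv: "\<And>S. model_prior a c X S > 0 \<Longrightarrow> invertible_mat (gram X S)"
    and s: "1 \<le> s" "s \<le> n" "n \<le> p"
    and q: "2 * sqrt (1 / (1 - (4 * t + \<alpha>))) \<le> q"
    and \<beta>: "\<beta>' \<in> carrier_vec p" "card (supp \<beta>') = s" and M: "M > 0"
  shows "(\<integral>\<^sup>+y. emeasure (posterior \<sigma> \<alpha> \<gamma> a c X y)
        {\<beta> \<in> carrier_vec p. mean_hellinger \<sigma> X \<beta>' \<beta> > M * sqrt (v / real n)} \<partial>response_dist X \<sigma> \<beta>')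
    \<le> ennreal (2 * (real p * q * sqrt (1 + \<alpha> / \<gamma>)) ^ s * exp (- 4 * t * M\<^sup>2 * v))"
proof -
  let ?A = "{\<beta> \<in> carrier_vec p. mean_hellinger \<sigma> X \<beta>' \<beta> > M * sqrt (v / real n)}"
  let ?r = "sqrt (1 / (1 - (4 * t + \<alpha>)))"
  have p: "dim_col X = p" using X by simp
  \<comment> \<open>All constraints on \<open>t\<close> follow from
    \<open>\<alpha> * (1 - \<alpha>)\<close> lying below both \<alpha> and
    \<open>1 - \<alpha>\<close>.\<close>
  have \<alpha>1: "0 < \<alpha> * (1 - \<alpha>)" using assms by simp
  then have "0 < t" by (simp add: t_def)
  have "\<alpha> * (1 - \<alpha>) \<le> \<alpha>" using assms by (simp add: mult_le_cancel_left2)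
  then have "4 * t \<le> \<alpha>" using \<alpha>1 by (simp add: t_def)
  have "\<alpha> * (1 - \<alpha>) < 1 - \<alpha>" using assms by simp
  then have l: "4 * t + \<alpha> < 1" using \<alpha>1 unfolding t_def by linarith
  have t2: "2 * t \<le> \<alpha> * (1 - \<alpha>)" using \<alpha>1 by (simp add: t_def)
  have q0: "q > 0" using assms unfolding q_def by (intro mult_pos_pos) auto
  have S: "supp \<beta>' \<subseteq> {..<dim_col X}" using \<beta> p by (auto simp: supp_def)
  have r0: "0 \<le> ?r" using l by simp
  note prior = prior_sum_ratio_le[of ?r c X a "supp \<beta>'", unfolded p, folded q_def, OF r0 q q0 S[unfolded p]]
  have pos: "model_prior a c X (supp \<beta>') > 0"
    using prior(1) \<beta> s rank by simp
  have v0: "v \<ge> 0" unfolding v_def using s by (intro mult_nonneg_nonneg ln_ge_zero) auto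
  have tail: "4 * t * M\<^sup>2 * v \<le> t * ((X *\<^sub>v \<beta> - X *\<^sub>v \<beta>') \<bullet> (X *\<^sub>v \<beta> - X *\<^sub>v \<beta>')) / \<sigma>\<^sup>2"
    if b: "\<beta> \<in> carrier_vec p" "\<beta> \<in> ?A" for \<beta>
  proof -
    have "(M * sqrt (v / real n))\<^sup>2 \<le> (mean_hellinger \<sigma> X \<beta>' \<beta>)\<^sup>2"
      using b M v0 by (intro power_mono) auto
    also have "\<dots> \<le> ((X *\<^sub>v \<beta> - X *\<^sub>v \<beta>') \<bullet> (X *\<^sub>v \<beta> - X *\<^sub>v \<beta>')) / (4 * \<sigma>\<^sup>2 * real n)"
      by (rule mean_hellinger_sq_le[OF assms(4) X n b(1) \<beta>(1)])
    finally have "M\<^sup>2 * (v / real n) \<le> ((X *\<^sub>v \<beta> - X *\<^sub>v \<beta>') \<bullet> (X *\<^sub>v \<beta> - X *\<^sub>v \<beta>')) / (4 * \<sigma>\<^sup>2 * real n)"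
      using v0 by (simp add: power_mult_distrib)
    then have "4 * M\<^sup>2 * v \<le> ((X *\<^sub>v \<beta> - X *\<^sub>v \<beta>') \<bullet> (X *\<^sub>v \<beta> - X *\<^sub>v \<beta>')) / \<sigma>\<^sup>2"
      using n assms(4) by (simp add: field_simps)
    from mult_left_mono[OF this, of t] show ?thesis using \<open>0 < t\<close> by (simp add: mult_ac)
  qed
  let ?\<pi> = "model_prior a c X (supp \<beta>')"
  let ?\<Sigma> = "\<Sum>S\<in>Pow {..<p}. model_prior a c X S * ?r ^ card S"
  have "(\<integral>\<^sup>+y. emeasure (posterior \<sigma> \<alpha> \<gamma> a c X y) ?A \<partial>response_dist X \<sigma> \<beta>')
    \<le> ennreal (?\<Sigma> / (?\<pi> * sqrt (1 / (1 + \<alpha> / \<gamma>) ^ card (supp \<beta>'))) * exp (- (4 * t * M\<^sup>2 * v)))"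
    using tail \<open>0 < t\<close> by (intro nn_integral_posterior_le[OF assms(4,7,8) _ \<open>4 * t \<le> \<alpha>\<close> t2 l X \<beta>(1) pos inv]) auto
  also have "\<dots> \<le> ennreal (2 * (real p * q * sqrt (1 + \<alpha> / \<gamma>)) ^ s * exp (- 4 * t * M\<^sup>2 * v))"
  proof (intro ennreal_leI)
    have k: "1 / sqrt (1 / (1 + \<alpha> / \<gamma>) ^ s) = sqrt (1 + \<alpha> / \<gamma>) ^ s"
      by (simp add: real_sqrt_divide real_sqrt_power)
    have "?\<Sigma> / (?\<pi> * sqrt (1 / (1 + \<alpha> / \<gamma>) ^ s)) = ?\<Sigma> / ?\<pi> * sqrt (1 + \<alpha> / \<gamma>) ^ s"
      unfolding k[symmetric] by simp
    also have "\<dots> \<le> 2 * (real p * q) ^ s * sqrt (1 + \<alpha> / \<gamma>) ^ s"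
      using prior(2) \<beta>(2) s rank assms by (intro mult_right_mono) auto
    also have "\<dots> = 2 * (real p * q * sqrt (1 + \<alpha> / \<gamma>)) ^ s"
      by (simp add: power_mult_distrib)
    finally show "?\<Sigma> / (?\<pi> * sqrt (1 / (1 + \<alpha> / \<gamma>) ^ card (supp \<beta>'))) * exp (- (4 * t * M\<^sup>2 * v))
      \<le> 2 * (real p * q * sqrt (1 + \<alpha> / \<gamma>)) ^ s * exp (- 4 * t * M\<^sup>2 * v)"
      unfolding \<beta>(2) by (intro mult_mono) (use assms q0 in auto)
  qed
  finally show ?thesis .
qed

theorem theorem1:
  fixes X :: "nat \<Rightarrow> real mat" and p s :: "nat \<Rightarrow> nat"
    and \<sigma> \<alpha> \<gamma> a c :: real
  assumes "\<sigma> > 0" and "0 < \<alpha>" and "\<alpha> < 1" and "\<gamma> > 0" and "a > 0" and "c > 0"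
    and "\<And>n. n \<ge> 1 \<Longrightarrow> p n \<ge> n"
    and "\<And>n. n \<ge> 1 \<Longrightarrow> X n \<in> carrier_mat n (p n)"
    and "\<And>n. n \<ge> 1 \<Longrightarrow> mat_rank (X n) = n"
    and "\<And>n S. n \<ge> 1 \<Longrightarrow> model_prior a c (X n) S > 0 \<Longrightarrow> invertible_mat (gram (X n) S)"
    and "\<And>n. n \<ge> 1 \<Longrightarrow> 1 \<le> s n \<and> s n \<le> p n"
    and "(\<lambda>n. real (s n) * ln (real (p n) / real (s n))) \<in> o(\<lambda>n. real n)"
    and sparse: "(\<lambda>n. ln (real (p n))) \<in> O(\<lambda>n. ln (real (p n) / real (s n)))"
  shows "rate p s \<longlonglongrightarrow> 0 \<and>
    (\<exists>G M. G > 0 \<and> M > 0 \<and>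
      (\<exists>C>0. \<forall>n\<ge>1.
        (SUP \<beta>'\<in>{\<beta>' \<in> carrier_vec (p n). card (supp \<beta>') = s n}.
           \<integral>\<^sup>+y. emeasure (posterior \<sigma> \<alpha> \<gamma> a c (X n) y)
                  {\<beta> \<in> carrier_vec (p n). mean_hellinger \<sigma> (X n) \<beta>' \<beta> > M * rate p s n}
             \<partial>response_dist (X n) \<sigma> \<beta>')
          \<le> ennreal (C * exp (- G * real n * (rate p s n)\<^sup>2))) \<and>
      (\<lambda>n. exp (- G * real n * (rate p s n)\<^sup>2)) \<longlonglongrightarrow> 0)"
proof -
  define v where "v n = real (s n) * ln (real (p n) / real (s n))" for n
  define L where "L n = ln (real (p n) / real (s n))" for n
  have rate: "rate p s n = sqrt (v n / real n)" for n by (simp add: rate_def v_def)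
  have L0: "L n \<ge> 0" and vL: "v n = real (s n) * L n" if "n \<ge> 1" for n
    using assms(11)[OF that] by (auto simp: L_def v_def)
  have v0: "v n \<ge> 0" if "n \<ge> 1" for n using L0 vL that by simp
  have nr: "real n * (rate p s n)\<^sup>2 = v n" if "n \<ge> 1" for n
    using v0[OF that] that by (simp add: rate)
  have "(\<lambda>n. v n / real n) \<longlonglongrightarrow> 0"
    using smalloD_tendsto[OF assms(12)] unfolding v_def .
  then have lim: "rate p s \<longlonglongrightarrow> 0"
    unfolding rate[abs_def] using tendsto_real_sqrt by fastforce

  \<comment> \<open>Prior costs are counted in \<open>ln p\<close> and the rate in
    \<open>ln (p / s)\<close>; \<open>K\<close> is the exchange factor.\<close>
  obtain K where K: "K > 0" and evK: "eventually (\<lambda>n. norm (ln (real (p n))) \<le> K * norm (L n)) sequentially"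
    using sparse unfolding L_def by (elim landau_o.bigE)
  have evL: "eventually (\<lambda>n. ln (real (p n)) \<le> K * L n) sequentially"
    using evK eventually_ge_at_top[of 1]
  proof eventually_elim
    case (elim n)
    then show ?case using L0[of n] by simp
  qed
  have evp: "eventually (\<lambda>n. B \<le> ln (real (p n))) sequentially" for B
  proof -
    have "filterlim (\<lambda>n::nat. ln (real n)) at_top sequentially" by real_asymp
    then have "eventually (\<lambda>n. B \<le> ln (real n)) sequentially" by (simp add: filterlim_at_top)
    then show ?thesis using eventually_ge_at_top[of 1]
    proof eventually_elim
      case (elim n)
      then have "ln (real n) \<le> ln (real (p n))" using assms(7)[of n] by simp
      then show ?case using elim by linarith
    qed
  qed

  define t where "t = \<alpha> * (1 - \<alpha>) / 8"
  \<comment> \<open>Twice the base of the bound for a single model: once \<open>c * p powr a\<close>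
    reaches it, the geometric series over sizes has ratio at most 1/2.\<close>
  define Q where "Q = 2 * sqrt (1 / (1 - (4 * t + \<alpha>)))"
  \<comment> \<open>The cost of the true model per unit of \<open>v\<close>: 1 for the number of
    models, \<open>a\<close> for the size prior, and the logarithm of the constants, absorbed by
    \<open>ln p \<ge> 1\<close>.\<close>
  define E where "E = (1 + a + \<bar>ln (c * sqrt (1 + \<alpha> / \<gamma>))\<bar>) * K"
  \<comment> \<open>Solves \<open>4 * t * M\<^sup>2 = E + 1\<close>: the threshold repays the cost
    \<open>E\<close> and leaves one unit of \<open>v\<close>, so that \<open>G\<close> can be
    1.\<close>
  define M where "M = sqrt ((E + 1) / (4 * t))"
  have t0: "t > 0" using assms by (simp add: t_def)
  have E0: "E \<ge> 0" using assms K by (simp add: E_def)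
  have M0: "M > 0" using t0 E0 by (simp add: M_def)
  have tM: "4 * t * M\<^sup>2 = E + 1" using t0 E0 by (simp add: M_def)

  have evq: "eventually (\<lambda>n. Q \<le> c * real (p n) powr a) sequentially"
  proof -
    have "filterlim (\<lambda>n::nat. c * real n powr a) at_top sequentially" using assms(5,6) by real_asymp
    then have "eventually (\<lambda>n. Q \<le> c * real n powr a) sequentially" by (simp add: filterlim_at_top)
    then show ?thesis using eventually_ge_at_top[of 1]
    proof eventually_elim
      case (elim n)
      then have "c * real n powr a \<le> c * real (p n) powr a"
        using assms(5,6) assms(7)[of n] by (intro mult_left_mono powr_mono2) auto
      then show ?case using elim by linarith
    qed
  qed
  \<comment> \<open>Puts the true support within the rank. From
    \<open>1 \<le> ln p \<le> K * L\<close> follows \<open>s \<le> K * v\<close>, and the little-o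
    hypothesis with constant \<open>1 / K\<close> bounds this by \<open>n\<close>.\<close>
  have evs: "eventually (\<lambda>n. s n \<le> n) sequentially"
  proof -
    have "eventually (\<lambda>n. norm (v n) \<le> 1 / K * norm (real n)) sequentially"
      using landau_o.smallD[OF assms(12), of "1 / K"] K unfolding v_def by simp
    then show ?thesis using evL evp[of 1] eventually_ge_at_top[of 1]
    proof eventually_elim
      case (elim n)
      then have "1 \<le> K * L n" by linarith
      then have "real (s n) * 1 \<le> real (s n) * (K * L n)" by (intro mult_left_mono) auto
      also have "\<dots> = K * v n" using vL elim by simp
      also have "\<dots> \<le> K * (1 / K * real n)" using elim K v0 by (intro mult_left_mono) auto
      finally show ?case using K by simp
    qed
  qed

  have "eventually (\<lambda>n. n \<ge> 1 \<and> s n \<le> n \<and> Q \<le> c * real (p n) powr a \<and> 1 \<le> ln (real (p n)) \<and> ln (real (p n)) \<le> K * L n) sequentially"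
    using evs evq evp[of 1] evL eventually_ge_at_top[of 1] by eventually_elim auto
  then obtain N where N: "\<And>n. n \<ge> N \<Longrightarrow> n \<ge> 1 \<and> s n \<le> n \<and> Q \<le> c * real (p n) powr a \<and> 1 \<le> ln (real (p n)) \<and> ln (real (p n)) \<le> K * L n"
    by (auto simp: eventually_sequentially)
  \<comment> \<open>The 2 is the constant of the tail bound from \<open>N\<close> on. Below
    \<open>N\<close> the summand \<open>exp (v n)\<close> raises \<open>C * exp (- v n)\<close> to
    at least 1, the trivial bound.\<close>
  define C where "C = 2 + (\<Sum>n<N. exp (v n))"
  have C2: "C \<ge> 2" unfolding C_def by (simp add: sum_nonneg)

  have bound: "(\<integral>\<^sup>+y. emeasure (posterior \<sigma> \<alpha> \<gamma> a c (X n) y)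
                  {\<beta> \<in> carrier_vec (p n). mean_hellinger \<sigma> (X n) \<beta>' \<beta> > M * rate p s n}
             \<partial>response_dist (X n) \<sigma> \<beta>') \<le> ennreal (C * exp (- v n))"
    if n: "n \<ge> 1" and \<beta>: "\<beta>' \<in> carrier_vec (p n)" "card (supp \<beta>') = s n" for n \<beta>'
  proof (cases "n < N")
    case True
    then have "exp (v n) \<le> C" unfolding C_def
      using member_le_sum[of n "{..<N}" "\<lambda>n. exp (v n)"] by simp
    then have "1 \<le> C * exp (- v n)" by (simp add: exp_minus field_simps)
    then have "1 \<le> ennreal (C * exp (- v n))" by simp
    then show ?thesis
      using nn_integral_posterior_le_1[OF assms(1) assms(8)[OF n] \<beta>(1)] by (rule order_trans[rotated])
  next
    case False
    then have Nn: "s n \<le> n" "Q \<le> c * real (p n) powr a" "1 \<le> ln (real (p n))" "ln (real (p n)) \<le> K * L n"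
      using N[of n] by auto
    let ?k = "sqrt (1 + \<alpha> / \<gamma>)"
    have k: "?k > 0" using assms by (simp add: add_pos_pos)
    have p0: "real (p n) > 0" using assms(7)[OF n] n by simp
    have ln_eq: "ln (real (p n) * (c * real (p n) powr a) * ?k) = (1 + a) * ln (real (p n)) + ln (c * ?k)"
      using p0 k assms(6) by (simp add: ln_mult ln_powr algebra_simps)
    also have "\<dots> \<le> (1 + a) * ln (real (p n)) + \<bar>ln (c * ?k)\<bar> * ln (real (p n))"
      using Nn(3) mult_left_mono[of 1 "ln (real (p n))" "\<bar>ln (c * ?k)\<bar>"] by auto
    also have "\<dots> = (1 + a + \<bar>ln (c * ?k)\<bar>) * ln (real (p n))" by (simp add: algebra_simps)
    also have "\<dots> \<le> (1 + a + \<bar>ln (c * ?k)\<bar>) * (K * L n)"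
      using Nn(4) assms(5) by (intro mult_left_mono) auto
    finally have "ln (real (p n) * (c * real (p n) powr a) * ?k) \<le> E * L n"
      by (simp add: E_def mult_ac)
    then have "real (s n) * ln (real (p n) * (c * real (p n) powr a) * ?k) \<le> real (s n) * (E * L n)"
      by (rule mult_left_mono) simp
    then have "real (s n) * ln (real (p n) * (c * real (p n) powr a) * ?k) \<le> E * v n"
      using vL[OF n] by (simp add: mult_ac)
    moreover have "(real (p n) * (c * real (p n) powr a) * ?k) ^ s n
      = exp (real (s n) * ln (real (p n) * (c * real (p n) powr a) * ?k))"
      using p0 k assms(6) by (simp add: exp_of_nat_mult)
    ultimately have "(real (p n) * (c * real (p n) powr a) * ?k) ^ s n \<le> exp (E * v n)" by simp
    then have "2 * (real (p n) * (c * real (p n) powr a) * ?k) ^ s n * exp (- 4 * t * M\<^sup>2 * v n)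
      \<le> 2 * exp (E * v n) * exp (- 4 * t * M\<^sup>2 * v n)"
      by (intro mult_right_mono mult_left_mono) auto
    also have "\<dots> = 2 * exp (- v n)"
    proof -
      have "- 4 * t * M\<^sup>2 * v n = - (E + 1) * v n" by (simp flip: tM)
      then show ?thesis by (simp add: exp_add[symmetric] algebra_simps)
    qed
    also have "\<dots> \<le> C * exp (- v n)" using C2 by (intro mult_right_mono) auto
    finally have "2 * (real (p n) * (c * real (p n) powr a) * ?k) ^ s n * exp (- 4 * t * M\<^sup>2 * v n) \<le> C * exp (- v n)" .
    moreover have "(\<integral>\<^sup>+y. emeasure (posterior \<sigma> \<alpha> \<gamma> a c (X n) y)
                  {\<beta> \<in> carrier_vec (p n). mean_hellinger \<sigma> (X n) \<beta>' \<beta> > M * rate p s n}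
             \<partial>response_dist (X n) \<sigma> \<beta>') \<le>
      ennreal (2 * (real (p n) * (c * real (p n) powr a) * ?k) ^ s n * exp (- 4 * t * M\<^sup>2 * v n))"
      unfolding rate t_def v_def
      using assms(11)[OF n] Nn(1,2)
      by (intro nn_integral_posterior_tail_le[OF assms(1-4,6) n assms(8)[OF n] assms(9)[OF n] assms(10)[OF n] _ _ assms(7)[OF n] _ \<beta> M0])
         (auto simp: Q_def t_def)
    ultimately show ?thesis by (meson ennreal_leI order_trans)
  qed

  have limv: "(\<lambda>n. exp (- v n)) \<longlonglongrightarrow> 0"
  proof -
    \<comment> \<open>As \<open>s n \<ge> 1\<close>, \<open>v\<close> is at least \<open>L\<close>,
      which is eventually at least \<open>ln p / K\<close> and so diverges.\<close>
    have "eventually (\<lambda>n. B \<le> v n) sequentially" for B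
      using evL evp[of "K * B"] eventually_ge_at_top[of 1]
    proof eventually_elim
      case (elim n)
      then have "B \<le> L n" using K by (meson mult_le_cancel_left_pos order_trans)
      also have "\<dots> \<le> v n" using vL[of n] L0[of n] assms(11)[of n] elim
        by (simp add: mult_le_cancel_right1)
      finally show ?case .
    qed
    then have "filterlim v at_top sequentially" by (simp add: filterlim_at_top)
    then have "filterlim (\<lambda>n. - v n) at_bot sequentially" by (simp add: filterlim_uminus_at_top)
    then show ?thesis by (rule filterlim_compose[OF exp_at_bot])
  qed
  \<comment> \<open>At \<open>n = 0\<close> the left side is 0 while \<open>v 0\<close> is
    unconstrained, so the limit is transferred along an eventual equality.\<close>
  have eqv: "- 1 * real n * (rate p s n)\<^sup>2 = - v n" if "n \<ge> 1" for n using nr[OF that] by simp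
  have "eventually (\<lambda>n. exp (- v n) = exp (- 1 * real n * (rate p s n)\<^sup>2)) sequentially"
    using eventually_ge_at_top[of 1] by eventually_elim (simp only: eqv)
  with limv have lim_exp: "(\<lambda>n. exp (- 1 * real n * (rate p s n)\<^sup>2)) \<longlonglongrightarrow> 0"
    by (rule Lim_transform_eventually)
  have sup: "(SUP \<beta>'\<in>{\<beta>' \<in> carrier_vec (p n). card (supp \<beta>') = s n}.
         \<integral>\<^sup>+y. emeasure (posterior \<sigma> \<alpha> \<gamma> a c (X n) y)
                {\<beta> \<in> carrier_vec (p n). mean_hellinger \<sigma> (X n) \<beta>' \<beta> > M * rate p s n}
           \<partial>response_dist (X n) \<sigma> \<beta>')
        \<le> ennreal (C * exp (- 1 * real n * (rate p s n)\<^sup>2))" if "n \<ge> 1" for n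
    unfolding eqv[OF that] using bound[OF that] by (intro SUP_least) auto
  have C0: "C > 0" using C2 by simp
  show ?thesis
  proof (rule conjI[OF lim], rule exI[of _ "1 :: real"], rule exI[of _ M], intro conjI)
    show "\<exists>C>0. \<forall>n\<ge>1.
        (SUP \<beta>'\<in>{\<beta>' \<in> carrier_vec (p n). card (supp \<beta>') = s n}.
           \<integral>\<^sup>+y. emeasure (posterior \<sigma> \<alpha> \<gamma> a c (X n) y)
                  {\<beta> \<in> carrier_vec (p n). mean_hellinger \<sigma> (X n) \<beta>' \<beta> > M * rate p s n}
             \<partial>response_dist (X n) \<sigma> \<beta>')
          \<le> ennreal (C * exp (- 1 * real n * (rate p s n)\<^sup>2))"
      using C0 sup by (intro exI[of _ C]) simp
  qed (use M0 lim_exp in auto)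
qed

end
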